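(* Let $n\ge0$. The assignment $z_0\mapsto y_0$, $z_1\mapsto y_1$, $z_2\mapsto y_2$ induces a well-defined isomorphism of graded Poisson algebras $$\mathcal P_n=k[z_0,z_1,z_2]/\big((z_1^2-z_0z_2)+\mathfrak m^{n+1}\big)\;\longrightarrow\;\mathcal P(\mathcal O_n),$$ where $\mathfrak m=(z_0,z_1,z_2)$.
   Context: $k$ is a field of characteristic zero, $\mathcal O_n=k[x]/(x^{n+1})$ with elements identified with multiplication operators. The order filtration is $\mathcal D^p(\mathcal O_n)=\{\delta\in\operatorname{End}_k(\mathcal O_n):[f_0,[f_1,\dots,[f_p,\delta]\dots]]=0\ \forall f_i\in\mathcal O_n\}$ ($\mathcal D^{-1}=0$), and $\mathcal P(\mathcal O_n)=\bigoplus_{p\ge0}\mathcal D^p(\mathcal O_n)/\mathcal D^{p-1}(\mathcal O_n)$ is the associated graded commutative algebra, a graded Poisson algebra with bracket $\{\delta+\mathcal D^{p-1},\epsilon+\mathcal D^{q-1}\}=[\delta,\epsilon]+\mathcal D^{p+q-2}$ for $\delta\in\mathcal D^p,\epsilon\in\mathcal D^q$. Let $y_0,y_1,y_2$ be the classes in $\mathcal P^0,\mathcal P^1,\mathcal P^2$ of the operators $x$, $-x\frac{d}{dx}+\frac n2$, $x\frac{d^2}{dx^2}-n\frac{d}{dx}$ respectively. The polynomial algebra $k[z_0,z_1,z_2]$ is graded by $\deg z_p=p$ and carries the graded Poisson bracket (Kirillov–Kostant structure of $\mathrm{Sym}(\mathrm{sl}_2)$ under $z_0=e$, $z_1=-\tfrac12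 h$, $z_2=-f$) determined by $\{z_0,z_1\}=z_0$, $\{z_0,z_2\}=2z_1$, $\{z_1,z_2\}=z_2$; the ideal $(z_1^2-z_0z_2)+\mathfrak m^{n+1}$ is a homogeneous Poisson ideal, so $\mathcal P_n$ is a graded Poisson algebra. *)

theory Defs
  imports "HOL-Computational_Algebra.Polynomial"
begin

text \<open>Elements of O_n are represented by their canonical representatives, the
polynomials of degree at most n (remainders modulo x^(n+1)).  k-linear
endomorphisms of O_n are represented by functions on polynomials; only their
values on O_n matter (all relations below are tested on O_n only).\<close>

type_synonym 'a op = "'a poly \<Rightarrow> 'a poly"

definition On :: "nat \<Rightarrow> 'a::field poly set" where
  "On n = {p. degree p \<le> n}"

definition mulop :: "nat \<Rightarrow> 'a::field poly \<Rightarrow> 'a op" where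
  "mulop n f = (\<lambda>u. (f * u) mod monom 1 (Suc n))"

definition End_On :: "nat \<Rightarrow> ('a::field op) set" where
  "End_On n = {\<delta>. (\<forall>u\<in>On n. \<delta> u \<in> On n)
     \<and> (\<forall>u\<in>On n. \<forall>v\<in>On n. \<delta> (u + v) = \<delta> u + \<delta> v)
     \<and> (\<forall>c. \<forall>u\<in>On n. \<delta> (smult c u) = smult c (\<delta> u))}"

fun itcomm :: "nat \<Rightarrow> 'a::field poly list \<Rightarrow> 'a op \<Rightarrow> 'a op" where
  "itcomm n [] \<delta> = \<delta>"
| "itcomm n (f # fs) \<delta> =
     (\<lambda>u. mulop n f (itcomm n fs \<delta> u) - itcomm n fs \<delta> (mulop n f u))"

text \<open>Order filtration D^p(O_n); for p = -1 (and below) this is {0}.\<close>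
definition Dord :: "nat \<Rightarrow> int \<Rightarrow> ('a::field op) set" where
  "Dord n p = {\<delta> \<in> End_On n. \<forall>fs. length fs = nat (p + 1) \<longrightarrow> set fs \<subseteq> On n \<longrightarrow>
        (\<forall>u\<in>On n. itcomm n fs \<delta> u = 0)}"

text \<open>An element of P(O_n) = \<Oplus>_p D^p/D^(p-1) is represented by a family g with
g p \<in> D^p, almost all components in D^(p-1); two families represent the same
element iff g p - h p \<in> D^(p-1) for all p.\<close>

definition gr_elem :: "nat \<Rightarrow> (nat \<Rightarrow> 'a::field op) \<Rightarrow> bool" where
  "gr_elem n g \<longleftrightarrow> (\<forall>p. g p \<in> Dord n (int p))
      \<and> (\<exists>N. \<forall>p>N. g p \<in> Dord n (int p - 1))"

definition gr_eq :: "nat \<Rightarrow> (nat \<Rightarrow> 'a::field op) \<Rightarrow> (nat \<Rightarrow> 'a op) \<Rightarrow> bool" where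
  "gr_eq n g h \<longleftrightarrow> (\<forall>p. (\<lambda>u. g p u - h p u) \<in> Dord n (int p - 1))"

definition gr_zero :: "nat \<Rightarrow> 'a::field op" where
  "gr_zero p = (\<lambda>u. 0)"

definition gr_one :: "nat \<Rightarrow> 'a::field op" where
  "gr_one p = (if p = 0 then (\<lambda>u. u) else (\<lambda>u. 0))"

definition gr_add :: "(nat \<Rightarrow> 'a::field op) \<Rightarrow> (nat \<Rightarrow> 'a op) \<Rightarrow> nat \<Rightarrow> 'a op" where
  "gr_add g h p = (\<lambda>u. g p u + h p u)"

definition gr_mult :: "(nat \<Rightarrow> 'a::field op) \<Rightarrow> (nat \<Rightarrow> 'a op) \<Rightarrow> nat \<Rightarrow> 'a op" where
  "gr_mult g h p = (\<lambda>u. \<Sum>a\<le>p. g a (h (p - a) u))"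

text \<open>bracket: {\<delta> + D^(a-1), \<epsilon> + D^(b-1)} = [\<delta>,\<epsilon>] + D^(a+b-2), of degree a+b-1\<close>
definition gr_bracket :: "(nat \<Rightarrow> 'a::field op) \<Rightarrow> (nat \<Rightarrow> 'a op) \<Rightarrow> nat \<Rightarrow> 'a op" where
  "gr_bracket g h p = (\<lambda>u. \<Sum>a\<le>Suc p. g a (h (Suc p - a) u) - h (Suc p - a) (g a u))"

definition Y0 :: "nat \<Rightarrow> 'a::field_char_0 op" where
  "Y0 n = mulop n [:0, 1:]"

definition Y1 :: "nat \<Rightarrow> 'a::field_char_0 op" where
  "Y1 n = (\<lambda>u. - ([:0, 1:] * pderiv u) + smult (of_nat n / 2) u)"

definition Y2 :: "nat \<Rightarrow> 'a::field_char_0 op" where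
  "Y2 n = (\<lambda>u. [:0, 1:] * pderiv (pderiv u) - smult (of_nat n) (pderiv u))"

text \<open>k[z_0,z_1,z_2] is represented as k[z_0][z_1][z_2], i.e. the type
'a poly poly poly; the coefficient of z_0^a z_1^b z_2^c in F is
coeff (coeff (coeff F c) b) a.\<close>

type_synonym 'a mpoly3 = "'a poly poly poly"

definition z0 :: "'a::idom mpoly3" where "z0 = [:[:[:0, 1:]:]:]"
definition z1 :: "'a::idom mpoly3" where "z1 = [:[:0, 1:]:]"
definition z2 :: "'a::idom mpoly3" where "z2 = [:0, 1:]"

definition d0 :: "'a::idom mpoly3 \<Rightarrow> 'a mpoly3" where "d0 F = map_poly (map_poly pderiv) F"
definition d1 :: "'a::idom mpoly3 \<Rightarrow> 'a mpoly3" where "d1 F = map_poly pderiv F"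
definition d2 :: "'a::idom mpoly3 \<Rightarrow> 'a mpoly3" where "d2 F = pderiv F"

text \<open>Kirillov-Kostant bracket: {z0,z1} = z0, {z0,z2} = 2 z1, {z1,z2} = z2\<close>
definition pbracket :: "'a::idom mpoly3 \<Rightarrow> 'a mpoly3 \<Rightarrow> 'a mpoly3" where
  "pbracket F G =
      (d0 F * d1 G - d1 F * d0 G) * z0
    + (d0 F * d2 G - d2 F * d0 G) * (2 * z1)
    + (d1 F * d2 G - d2 F * d1 G) * z2"

definition monomial3 :: "nat \<Rightarrow> nat \<Rightarrow> nat \<Rightarrow> 'a::idom mpoly3" where
  "monomial3 a b c = z0 ^ a * z1 ^ b * z2 ^ c"

text \<open>The ideal (z_1^2 - z_0 z_2) + m^(n+1), m = (z_0,z_1,z_2): the ideal generated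
by z_1^2 - z_0 z_2 and all monomials of total degree n+1.\<close>
definition Ideal_n :: "nat \<Rightarrow> 'a::idom mpoly3 set" where
  "Ideal_n n = {F. \<exists>G H. F = (z1 ^ 2 - z0 * z2) * G
      + (\<Sum>(a, b, c) \<in> {(a, b, c). a + b + c = Suc n}. H (a, b, c) * monomial3 a b c)}"

text \<open>Degree-p component of the image of F: the homogeneous part of F of weighted
degree p (deg z_i = i) evaluated at the operators, z_0^a z_1^b z_2^c \<mapsto> x^a y_1^b y_2^c
(the ordering is irrelevant modulo D^(p-1)).\<close>
definition Phi :: "nat \<Rightarrow> 'a::field_char_0 mpoly3 \<Rightarrow> nat \<Rightarrow> 'a op" where
  "Phi n F p = (\<lambda>u. \<Sum>c\<le>p. \<Sum>b\<le>p. if b + 2 * c = p then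
       (\<Sum>a\<le>degree (coeff (coeff F c) b).
          smult (coeff (coeff (coeff F c) b) a)
            (((Y0 n ^^ a) \<circ> (Y1 n ^^ b) \<circ> (Y2 n ^^ c)) u))
     else 0)"

end

theory Submission
  imports Defs
begin

text \<open>Commutation with \<open>x\<close> alone determines the order filtration: \<open>D^p\<close> is the kernel of
  \<open>(ad x)^(p+1)\<close>.  Hence \<open>\<delta> \<mapsto> (ad x)^p \<delta> / p!\<close> embeds \<open>D^p / D^(p-1)\<close> into the multiplication operators
  and, by the Leibniz rule, embeds the associated graded algebra into \<open>O_n[\<xi>]\<close>.  The operators
  \<open>Y0, Y1, Y2\<close> go to \<open>x, x \<xi>, x \<xi>^2\<close>, so everything reduces to the homomorphism
  \<open>k[z0, z1, z2] \<rightarrow> k[x][\<xi>]\<close> with these values: its kernel is generated by \<open>z1^2 - z0 z2\<close>, and it turns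
  the Kirillov-Kostant bracket into \<open>F_x G_\<xi> - F_\<xi> G_x\<close>.  Its image is spanned by the \<open>x^d \<xi>^p\<close> with
  \<open>p \<le> 2 d\<close>; that symbols of operators also lie in this span follows by pairing with powers of \<open>Y2\<close>
  under the trace form.\<close>

section \<open>The order filtration\<close>

abbreviation trunc :: "nat \<Rightarrow> 'a::field poly \<Rightarrow> 'a poly" where
  "trunc n f \<equiv> f mod monom 1 (Suc n)"

lemma trunc_eq_self_iff: "trunc n f = f \<longleftrightarrow> f \<in> On n"
proof
  assume "trunc n f = f"
  then show "f \<in> On n"
    using degree_mod_less[of "monom (1::'a) (Suc n)" f]
    by (auto simp: On_def degree_monom_eq)
next
  assume "f \<in> On n"
  then show "trunc n f = f"
    by (intro mod_poly_less) (simp add: On_def degree_monom_eq)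
qed

lemma trunc_On [simp]: "trunc n f \<in> On n"
  by (simp flip: trunc_eq_self_iff)

lemma trunc_id: "f \<in> On n \<Longrightarrow> trunc n f = f"
  by (simp add: trunc_eq_self_iff)

lemma On_coeff: "f \<in> On n \<longleftrightarrow> (\<forall>k>n. coeff f k = 0)"
  by (auto simp: On_def coeff_eq_0 intro!: degree_le)

lemma coeff_trunc: "coeff (trunc n f) k = (if k \<le> n then coeff f k else 0)"
proof -
  have "coeff f k = coeff (f div monom 1 (Suc n) * monom 1 (Suc n) + trunc n f) k"
    by (simp only: div_mult_mod_eq)
  also have "\<dots> = coeff (f div monom 1 (Suc n) * monom 1 (Suc n)) k + coeff (trunc n f) k"
    by simp
  finally have "k \<le> n \<Longrightarrow> coeff f k = coeff (trunc n f) k"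
    by (simp add: mult.commute[of _ "monom 1 (Suc n)"] coeff_monom_mult)
  moreover have "k > n \<Longrightarrow> coeff (trunc n f) k = 0"
    using trunc_On[of f n] unfolding On_coeff by blast
  ultimately show ?thesis by auto
qed

lemma On_closed [simp, intro]:
  "0 \<in> On n" "1 \<in> On n"
  "f \<in> On n \<Longrightarrow> g \<in> On n \<Longrightarrow> f + g \<in> On n"
  "f \<in> On n \<Longrightarrow> g \<in> On n \<Longrightarrow> f - g \<in> On n"
  "f \<in> On n \<Longrightarrow> - f \<in> On n"
  "f \<in> On n \<Longrightarrow> smult c f \<in> On n"
  by (auto simp: On_coeff)

lemma trunc_sum: "trunc n (sum f I) = (\<Sum>i\<in>I. trunc n (f i))"
  by (rule poly_eqI) (simp add: coeff_trunc coeff_sum)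

lemma trunc_simps:
  "trunc n (f + g) = trunc n f + trunc n g"
  "trunc n (f - g) = trunc n f - trunc n g"
  "trunc n (smult c f) = smult c (trunc n f)"
  "trunc n 0 = 0"
  by (simp_all add: poly_mod_add_left poly_mod_diff_left mod_smult_left)

lemma mulop_simps:
  "mulop n f (u + v) = mulop n f u + mulop n f v"
  "mulop n f (u - v) = mulop n f u - mulop n f v"
  "mulop n f (smult c u) = smult c (mulop n f u)"
  "mulop n f 0 = 0"
  "mulop n f (sum h I) = (\<Sum>i\<in>I. mulop n f (h i))"
  by (simp_all add: mulop_def distrib_left right_diff_distrib trunc_simps trunc_sum sum_distrib_left)

lemma mulop_On [simp]: "mulop n f u \<in> On n"
  by (simp add: mulop_def)

lemma mulop_trunc: "mulop n (trunc n f) = mulop n f"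
  by (simp add: mulop_def mod_mult_left_eq)

lemma mulop_commute: "mulop n f (mulop n g u) = mulop n g (mulop n f u)"
  by (simp add: mulop_def mod_mult_right_eq mult.left_commute)

lemma End_On_D:
  assumes "\<delta> \<in> End_On n"
  shows "u \<in> On n \<Longrightarrow> \<delta> u \<in> On n"
    "u \<in> On n \<Longrightarrow> v \<in> On n \<Longrightarrow> \<delta> (u + v) = \<delta> u + \<delta> v"
    "u \<in> On n \<Longrightarrow> v \<in> On n \<Longrightarrow> \<delta> (u - v) = \<delta> u - \<delta> v"
    "u \<in> On n \<Longrightarrow> \<delta> (smult c u) = smult c (\<delta> u)"
    "\<delta> 0 = 0"
proof -
  show add: "u \<in> On n \<Longrightarrow> v \<in> On n \<Longrightarrow> \<delta> (u + v) = \<delta> u + \<delta> v" for u v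
    using assms by (simp add: End_On_def)
  show sm: "u \<in> On n \<Longrightarrow> \<delta> (smult c u) = smult c (\<delta> u)" for u c
    using assms by (simp add: End_On_def)
  show "u \<in> On n \<Longrightarrow> \<delta> u \<in> On n" using assms by (simp add: End_On_def)
  show "\<delta> 0 = 0" using sm[of 0 0] by simp
  show "\<delta> (u - v) = \<delta> u - \<delta> v" if "u \<in> On n" "v \<in> On n"
    using add[of u "smult (-1) v"] sm[of v "-1"] that by simp
qed

lemma End_On_I:
  assumes "\<And>u. u \<in> On n \<Longrightarrow> \<delta> u \<in> On n"
    "\<And>u v. u \<in> On n \<Longrightarrow> v \<in> On n \<Longrightarrow> \<delta> (u + v) = \<delta> u + \<delta> v"
    "\<And>c u. u \<in> On n \<Longrightarrow> \<delta> (smult c u) = smult c (\<delta> u)"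
  shows "\<delta> \<in> End_On n"
  using assms by (simp add: End_On_def)

lemma End_On_zero: "(\<lambda>u. 0) \<in> End_On n"
  by (rule End_On_I) simp_all

lemma End_On_id: "(\<lambda>u. u) \<in> End_On n"
  by (rule End_On_I) simp_all

lemma End_On_add:
  assumes "\<delta> \<in> End_On n" "\<epsilon> \<in> End_On n"
  shows "(\<lambda>u. \<delta> u + \<epsilon> u) \<in> End_On n"
  by (rule End_On_I) (simp_all add: End_On_D[OF assms(1)] End_On_D[OF assms(2)] smult_add_right)

lemma End_On_diff:
  assumes "\<delta> \<in> End_On n" "\<epsilon> \<in> End_On n"
  shows "(\<lambda>u. \<delta> u - \<epsilon> u) \<in> End_On n"
  by (rule End_On_I) (simp_all add: End_On_D[OF assms(1)] End_On_D[OF assms(2)] smult_diff_right)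

lemma End_On_smult:
  assumes "\<delta> \<in> End_On n"
  shows "(\<lambda>u. smult c (\<delta> u)) \<in> End_On n"
  by (rule End_On_I) (simp_all add: End_On_D[OF assms] smult_add_right mult.commute)

lemma End_On_comp:
  assumes "\<delta> \<in> End_On n" "\<epsilon> \<in> End_On n"
  shows "(\<lambda>u. \<delta> (\<epsilon> u)) \<in> End_On n"
  by (rule End_On_I) (simp_all add: End_On_D[OF assms(1)] End_On_D[OF assms(2)])

lemma End_On_mulop: "mulop n f \<in> End_On n"
  by (rule End_On_I) (simp_all add: mulop_simps)

lemma End_On_mulop_comp:
  "\<delta> \<in> End_On n \<Longrightarrow> (\<lambda>u. mulop n f (\<delta> u)) \<in> End_On n"
  "\<delta> \<in> End_On n \<Longrightarrow> (\<lambda>u. \<delta> (mulop n f u)) \<in> End_On n"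
  using End_On_comp End_On_mulop by blast+

definition adx :: "nat \<Rightarrow> 'a::field op \<Rightarrow> 'a op" where
  "adx n \<delta> = (\<lambda>u. mulop n [:0, 1:] (\<delta> u) - \<delta> (mulop n [:0, 1:] u))"

lemma adx_apply: "adx n \<delta> u = mulop n [:0, 1:] (\<delta> u) - \<delta> (mulop n [:0, 1:] u)"
  by (simp add: adx_def)

lemma End_On_adx: "\<delta> \<in> End_On n \<Longrightarrow> adx n \<delta> \<in> End_On n"
  unfolding adx_def by (intro End_On_diff; erule End_On_mulop_comp)

lemma End_On_adx_pow: "\<delta> \<in> End_On n \<Longrightarrow> (adx n ^^ p) \<delta> \<in> End_On n"
  by (induction p) (simp_all add: End_On_adx)

lemma adx_linear:
  "adx n (\<lambda>u. \<delta> u + \<epsilon> u) = (\<lambda>u. adx n \<delta> u + adx n \<epsilon> u)"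
  "adx n (\<lambda>u. \<delta> u - \<epsilon> u) = (\<lambda>u. adx n \<delta> u - adx n \<epsilon> u)"
  "adx n (\<lambda>u. smult c (\<delta> u)) = (\<lambda>u. smult c (adx n \<delta> u))"
  "adx n (\<lambda>u. 0) = (\<lambda>u. 0)"
  by (simp_all add: adx_def mulop_simps smult_diff_right fun_eq_iff)

lemma adx_pow_linear:
  "(adx n ^^ p) (\<lambda>u. \<delta> u + \<epsilon> u) = (\<lambda>u. (adx n ^^ p) \<delta> u + (adx n ^^ p) \<epsilon> u)"
  "(adx n ^^ p) (\<lambda>u. \<delta> u - \<epsilon> u) = (\<lambda>u. (adx n ^^ p) \<delta> u - (adx n ^^ p) \<epsilon> u)"
  "(adx n ^^ p) (\<lambda>u. smult c (\<delta> u)) = (\<lambda>u. smult c ((adx n ^^ p) \<delta> u))"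
  "(adx n ^^ p) (\<lambda>u. 0) = (\<lambda>u. 0)"
  by (induction p) (simp_all add: adx_linear)

lemma adx_pow_cong:
  assumes "\<And>u. u \<in> On n \<Longrightarrow> \<delta> u = \<epsilon> u" "u \<in> On n"
  shows "(adx n ^^ p) \<delta> u = (adx n ^^ p) \<epsilon> u"
  using assms(2)
proof (induction p arbitrary: u)
  case (Suc p)
  show ?case
    by (simp add: adx_apply[of n "(adx n ^^ p) \<delta>" u] adx_apply[of n "(adx n ^^ p) \<epsilon>" u]
        Suc.IH[OF Suc.prems] Suc.IH[OF mulop_On])
qed (simp add: assms(1))

definition adnil :: "nat \<Rightarrow> nat \<Rightarrow> 'a::field op set" where
  "adnil n p = {\<delta> \<in> End_On n. \<forall>u\<in>On n. (adx n ^^ p) \<delta> u = 0}"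

lemma adnil_End: "\<delta> \<in> adnil n p \<Longrightarrow> \<delta> \<in> End_On n"
  by (simp add: adnil_def)

lemma adnil_cong:
  assumes "\<And>u. u \<in> On n \<Longrightarrow> \<delta> u = \<epsilon> u" "\<epsilon> \<in> End_On n" "\<delta> \<in> adnil n p"
  shows "\<epsilon> \<in> adnil n p"
proof -
  have "(adx n ^^ p) \<epsilon> u = 0" if "u \<in> On n" for u
    using assms(3) that adx_pow_cong[of n \<delta> \<epsilon> u p, OF assms(1)] by (simp add: adnil_def)
  with assms(2) show ?thesis by (simp add: adnil_def)
qed

lemma adnil_zero: "(\<lambda>u. 0) \<in> adnil n p"
  by (simp add: adnil_def End_On_zero adx_pow_linear)

lemma adnil_add: "\<delta> \<in> adnil n p \<Longrightarrow> \<epsilon> \<in> adnil n p \<Longrightarrow> (\<lambda>u. \<delta> u + \<epsilon> u) \<in> adnil n p"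
  by (simp add: adnil_def End_On_add adx_pow_linear)

lemma adnil_diff: "\<delta> \<in> adnil n p \<Longrightarrow> \<epsilon> \<in> adnil n p \<Longrightarrow> (\<lambda>u. \<delta> u - \<epsilon> u) \<in> adnil n p"
  by (simp add: adnil_def End_On_diff adx_pow_linear)

lemma adnil_smult: "\<delta> \<in> adnil n p \<Longrightarrow> (\<lambda>u. smult c (\<delta> u)) \<in> adnil n p"
  by (simp add: adnil_def End_On_smult adx_pow_linear)

lemma adnil_Suc: "\<delta> \<in> adnil n (Suc p) \<longleftrightarrow> \<delta> \<in> End_On n \<and> adx n \<delta> \<in> adnil n p"
proof -
  have "(adx n ^^ Suc p) \<delta> = (adx n ^^ p) (adx n \<delta>)"
    by (simp only: funpow_Suc_right comp_apply)
  then show ?thesis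
    unfolding adnil_def using End_On_adx[of \<delta> n] by (simp only: mem_Collect_eq) blast
qed

lemma adnil_mono: "\<delta> \<in> adnil n p \<Longrightarrow> p \<le> q \<Longrightarrow> \<delta> \<in> adnil n q"
proof (induction q arbitrary: \<delta> p)
  case (Suc q)
  show ?case
  proof (cases p)
    case 0
    then have "\<And>u. u \<in> On n \<Longrightarrow> 0 = \<delta> u" using Suc.prems by (simp add: adnil_def)
    then show ?thesis
      by (rule adnil_cong[OF _ adnil_End[OF Suc.prems(1)] adnil_zero])
  next
    case (Suc p')
    then show ?thesis using Suc.IH[of "adx n \<delta>" p'] Suc.prems by (simp add: adnil_Suc)
  qed
qed simp

lemma adnil_mulop_left: "\<delta> \<in> adnil n p \<Longrightarrow> (\<lambda>u. mulop n f (\<delta> u)) \<in> adnil n p"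
proof (induction p arbitrary: \<delta>)
  case 0
  then show ?case by (simp add: adnil_def mulop_simps End_On_mulop_comp)
next
  case (Suc p)
  have "adx n (\<lambda>u. mulop n f (\<delta> u)) = (\<lambda>u. mulop n f (adx n \<delta> u))"
    by (simp add: adx_def fun_eq_iff mulop_simps mulop_commute)
  with Suc show ?case by (simp add: adnil_Suc End_On_mulop_comp)
qed

lemma adnil_mulop_right: "\<delta> \<in> adnil n p \<Longrightarrow> (\<lambda>u. \<delta> (mulop n f u)) \<in> adnil n p"
proof (induction p arbitrary: \<delta>)
  case 0
  then show ?case
    using End_On_mulop_comp(2)[of \<delta> n f] by (simp add: adnil_def)
next
  case (Suc p)
  have "adx n (\<lambda>u. \<delta> (mulop n f u)) = (\<lambda>u. adx n \<delta> (mulop n f u))"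
    by (simp add: adx_def fun_eq_iff mulop_simps mulop_commute)
  with Suc show ?case
    by (simp add: adnil_Suc End_On_mulop_comp)
qed

lemma mulop_pCons: "u \<in> On n \<Longrightarrow> mulop n (pCons c f) u = smult c u + mulop n [:0,1:] (mulop n f u)"
proof -
  assume u: "u \<in> On n"
  have "mulop n (pCons c f) u = smult c u + trunc n ([:0,1:] * (f * u))"
    using u by (simp add: mulop_def trunc_simps trunc_id)
  also have "trunc n ([:0,1:] * (f * u)) = mulop n [:0,1:] (mulop n f u)"
    by (simp only: mulop_def mod_mult_right_eq)
  finally show ?thesis .
qed

text \<open>Since \<open>f \<otimes> 1 - 1 \<otimes> f\<close> is a multiple of \<open>x \<otimes> 1 - 1 \<otimes> x\<close>, commutation with \<open>x\<close> alone
  determines the order filtration.\<close>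

lemma adnil_commutator:
  assumes "\<delta> \<in> adnil n (Suc p)"
  shows "(\<lambda>u. mulop n f (\<delta> u) - \<delta> (mulop n f u)) \<in> adnil n p"
proof (induction f)
  case 0
  have "\<delta> 0 = 0" using assms adnil_End End_On_D(5) by blast
  then show ?case by (simp add: mulop_def adnil_zero)
next
  case (pCons c f)
  have E: "\<delta> \<in> End_On n" using assms adnil_End by blast
  have "adx n \<delta> \<in> adnil n p" using assms by (simp add: adnil_Suc)
  then have mem: "(\<lambda>u. mulop n [:0,1:] (mulop n f (\<delta> u) - \<delta> (mulop n f u))
          + adx n \<delta> (mulop n f u)) \<in> adnil n p"
    by (rule adnil_add[OF adnil_mulop_left[OF pCons.IH] adnil_mulop_right])
  show ?case
  proof (rule adnil_cong[OF _ _ mem])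
    show "(\<lambda>u. mulop n (pCons c f) (\<delta> u) - \<delta> (mulop n (pCons c f) u)) \<in> End_On n"
      by (rule End_On_diff[OF End_On_mulop_comp(1)[OF E] End_On_mulop_comp(2)[OF E]])
    fix u :: "'a poly" assume u: "u \<in> On n"
    show "mulop n [:0,1:] (mulop n f (\<delta> u) - \<delta> (mulop n f u)) + adx n \<delta> (mulop n f u) =
          mulop n (pCons c f) (\<delta> u) - \<delta> (mulop n (pCons c f) u)"
      using u by (simp add: mulop_pCons[of _ n c f] End_On_D[OF E] adx_apply mulop_simps)
  qed
qed

lemma itcomm_adnil:
  "\<delta> \<in> adnil n (length fs + m) \<Longrightarrow> itcomm n fs \<delta> \<in> adnil n m"
proof (induction fs arbitrary: m)
  case (Cons f fs)
  then have "itcomm n fs \<delta> \<in> adnil n (Suc m)" by simp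
  then show ?case using adnil_commutator by auto
qed simp

lemma Dord_eq_adnil: "Dord n q = adnil n (nat (q + 1))"
proof (intro equalityI subsetI)
  fix \<delta> :: "'a op" assume \<delta>: "\<delta> \<in> Dord n q"
  have eq: "itcomm n (replicate p (trunc n [:0,1:])) \<delta> = (adx n ^^ p) \<delta>" for p
    by (induction p) (simp_all only: replicate.simps itcomm.simps funpow.simps comp_apply id_apply adx_def mulop_trunc)
  define fs :: "'a poly list" where "fs = replicate (nat (q + 1)) (trunc n [:0,1:])"
  have "length fs = nat (q + 1)" "set fs \<subseteq> On n"
    unfolding fs_def by (simp_all only: length_replicate set_replicate_conv_if) simp
  with \<delta> have "\<forall>u\<in>On n. itcomm n fs \<delta> u = 0" and "\<delta> \<in> End_On n"
    unfolding Dord_def mem_Collect_eq by blast+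
  then show "\<delta> \<in> adnil n (nat (q + 1))"
    unfolding fs_def eq adnil_def by blast
next
  fix \<delta> :: "'a op" assume \<delta>: "\<delta> \<in> adnil n (nat (q + 1))"
  show "\<delta> \<in> Dord n q"
    unfolding Dord_def mem_Collect_eq
  proof (intro conjI allI impI ballI)
    show "\<delta> \<in> End_On n" by (rule adnil_End[OF \<delta>])
    fix fs :: "'a poly list" and u :: "'a poly"
    assume "length fs = nat (q + 1)" and u: "u \<in> On n"
    with \<delta> have "itcomm n fs \<delta> \<in> adnil n 0" by (simp add: itcomm_adnil)
    with u show "itcomm n fs \<delta> u = 0" by (simp add: adnil_def)
  qed
qed

lemma Dord_int: "Dord n (int p) = adnil n (Suc p)" "Dord n (int p - 1) = adnil n p"
proof -
  have "nat (int p + 1) = Suc p" by linarith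
  then show "Dord n (int p) = adnil n (Suc p)" "Dord n (int p - 1) = adnil n p"
    by (simp_all only: Dord_eq_adnil diff_add_cancel nat_int)
qed

section \<open>Divided powers and symbols\<close>

lemma smult_cancel_left: "c \<noteq> 0 \<Longrightarrow> smult c p = smult c q \<longleftrightarrow> p = q"
  for c :: "'a::idom"
  by (simp add: poly_eq_iff)

lemma smult_sum_right: "smult c (sum f I) = (\<Sum>i\<in>I. smult c (f i))"
  by (induction I rule: infinite_finite_induct) (simp_all add: smult_add_right)

definition dpow :: "nat \<Rightarrow> nat \<Rightarrow> 'a::field_char_0 op \<Rightarrow> 'a op" where
  "dpow n i \<delta> = (\<lambda>u. smult (inverse (fact i)) ((adx n ^^ i) \<delta> u))"

lemma dpow_0 [simp]: "dpow n 0 \<delta> = \<delta>"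
  by (simp add: dpow_def)

lemma End_On_dpow: "\<delta> \<in> End_On n \<Longrightarrow> dpow n i \<delta> \<in> End_On n"
  unfolding dpow_def by (rule End_On_smult[OF End_On_adx_pow])

lemma dpow_Suc: "smult (of_nat (Suc m)) (dpow n (Suc m) \<delta> u) = adx n (dpow n m \<delta>) u"
proof -
  have "of_nat (Suc m) * inverse (fact (Suc m)) = (inverse (fact m) :: 'a)"
    by (simp add: field_simps del: of_nat_Suc)
  then show ?thesis
    by (simp only: dpow_def adx_linear(3) smult_smult funpow.simps comp_apply)
qed

lemma adx_comp:
  assumes "\<delta> \<in> End_On n" "\<epsilon> \<in> End_On n" "u \<in> On n"
  shows "adx n (\<lambda>u. \<delta> (\<epsilon> u)) u = adx n \<delta> (\<epsilon> u) + \<delta> (adx n \<epsilon> u)"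
  by (simp add: adx_apply[of n \<delta>] adx_apply[of n \<epsilon>] adx_apply[of n "\<lambda>u. \<delta> (\<epsilon> u)"]
      End_On_D[OF assms(1)] End_On_D[OF assms(2)] assms(3))

lemma dpow_comp:
  assumes \<delta>: "\<delta> \<in> End_On n" and \<epsilon>: "\<epsilon> \<in> End_On n" and u: "u \<in> On n"
  shows "dpow n m (\<lambda>u. \<delta> (\<epsilon> u)) u = (\<Sum>i\<le>m. dpow n i \<delta> (dpow n (m - i) \<epsilon> u))"
  using u
proof (induction m arbitrary: u)
  case (Suc m)
  define T where "T = (\<lambda>j. dpow n j \<delta> (dpow n (Suc m - j) \<epsilon> u))"
  have D: "dpow n i \<delta> \<in> End_On n" "dpow n i \<epsilon> \<in> End_On n" for i
    by (simp_all add: End_On_dpow \<delta> \<epsilon>)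
  let ?x = "mulop n [:0, 1:]"
  have "smult (of_nat (Suc m)) (dpow n (Suc m) (\<lambda>u. \<delta> (\<epsilon> u)) u)
      = adx n (dpow n m (\<lambda>u. \<delta> (\<epsilon> u))) u"
    by (rule dpow_Suc)
  also have "\<dots> = (\<Sum>i\<le>m. adx n (\<lambda>u. dpow n i \<delta> (dpow n (m - i) \<epsilon> u)) u)"
    by (simp add: adx_apply Suc.IH[OF Suc.prems] Suc.IH[OF mulop_On] mulop_simps sum_subtractf)
  also have "\<dots> = (\<Sum>i\<le>m. smult (of_nat (Suc i)) (T (Suc i)) + smult (of_nat (Suc m - i)) (T i))"
  proof (rule sum.cong)
    fix i assume i: "i \<in> {..m}"
    have "adx n (\<lambda>u. dpow n i \<delta> (dpow n (m - i) \<epsilon> u)) u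
        = adx n (dpow n i \<delta>) (dpow n (m - i) \<epsilon> u) + dpow n i \<delta> (adx n (dpow n (m - i) \<epsilon>) u)"
      by (rule adx_comp[OF D(1) D(2) Suc.prems])
    also have "adx n (dpow n i \<delta>) (dpow n (m - i) \<epsilon> u) = smult (of_nat (Suc i)) (T (Suc i))"
      by (simp add: T_def dpow_Suc del: of_nat_Suc)
    also have "dpow n i \<delta> (adx n (dpow n (m - i) \<epsilon>) u) = smult (of_nat (Suc m - i)) (T i)"
    proof -
      have "Suc m - i = Suc (m - i)" using i by auto
      then show ?thesis
        by (simp add: T_def dpow_Suc[symmetric] End_On_D[OF D(1)] End_On_D(1)[OF D(2)] Suc.prems
            del: of_nat_Suc)
    qed
    finally show "adx n (\<lambda>u. dpow n i \<delta> (dpow n (m - i) \<epsilon> u)) u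
        = smult (of_nat (Suc i)) (T (Suc i)) + smult (of_nat (Suc m - i)) (T i)" .
  qed simp
  also have "\<dots> = (\<Sum>i\<le>Suc m. smult (of_nat i) (T i)) + (\<Sum>i\<le>Suc m. smult (of_nat (Suc m - i)) (T i))"
  proof -
    have "(\<Sum>i\<le>m. smult (of_nat (Suc i)) (T (Suc i))) = (\<Sum>i\<le>Suc m. smult (of_nat i) (T i))"
      by (subst sum.atMost_Suc_shift) simp
    then show ?thesis by (simp add: sum.distrib)
  qed
  also have "\<dots> = (\<Sum>i\<le>Suc m. smult (of_nat (Suc m)) (T i))"
    unfolding sum.distrib[symmetric]
    by (rule sum.cong) (simp_all add: smult_add_left[symmetric] of_nat_add[symmetric]
        del: of_nat_add of_nat_Suc smult_add_left)
  also have "\<dots> = smult (of_nat (Suc m)) (\<Sum>i\<le>Suc m. T i)"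
    by (rule smult_sum_right[symmetric])
  finally have "dpow n (Suc m) (\<lambda>u. \<delta> (\<epsilon> u)) u = (\<Sum>i\<le>Suc m. T i)"
    by (rule smult_cancel_left[THEN iffD1, rotated]) (simp del: of_nat_Suc)
  then show ?case by (simp only: T_def)
qed simp

lemma adnil_iff_dpow: "\<delta> \<in> adnil n p \<longleftrightarrow> \<delta> \<in> End_On n \<and> (\<forall>u\<in>On n. dpow n p \<delta> u = 0)"
  by (simp add: adnil_def dpow_def)

lemma dpow_eq_0:
  assumes "\<delta> \<in> adnil n p" "p \<le> i" "u \<in> On n"
  shows "dpow n i \<delta> u = 0"
  using adnil_mono[OF assms(1,2)] assms(3) unfolding adnil_iff_dpow by blast

lemma first_order_operator:
  assumes \<theta>: "\<theta> \<in> End_On n" and h: "\<And>v. v \<in> On n \<Longrightarrow> adx n \<theta> v = trunc n (h * v)"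
    and f: "f \<in> On n"
  shows "\<theta> f = trunc n (f * \<theta> 1 - pderiv f * h)"
  using f
proof (induction f)
  case 0
  show ?case by (simp add: End_On_D(5)[OF \<theta>])
next
  case (pCons c f)
  have "coeff f k = 0" if "k > n" for k
    using pCons.prems that less_SucI[OF that] unfolding On_coeff by (metis coeff_pCons_Suc)
  then have f: "f \<in> On n" by (simp add: On_coeff)
  have xf: "[:0, 1:] * f \<in> On n"
    using On_closed(4)[OF pCons.prems On_closed(6)[OF On_closed(2), of c]] by simp
  have "\<theta> (pCons c f) = \<theta> (smult c 1 + [:0, 1:] * f)"
    by simp
  also have "\<dots> = smult c (\<theta> 1) + \<theta> ([:0, 1:] * f)"
    using xf by (simp only: End_On_D[OF \<theta>] On_closed)
  also have "\<theta> ([:0, 1:] * f) = \<theta> (mulop n [:0, 1:] f)"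
    using xf by (simp only: mulop_def trunc_id)
  also have "\<dots> = mulop n [:0, 1:] (\<theta> f) - trunc n (h * f)"
    using h[OF f] by (simp only: adx_apply) (simp add: algebra_simps)
  also have "mulop n [:0, 1:] (\<theta> f) = trunc n ([:0, 1:] * (f * \<theta> 1 - pderiv f * h))"
    by (simp only: pCons.IH[OF f] mulop_def mod_mult_right_eq)
  also have "smult c (\<theta> 1) = trunc n (smult c (\<theta> 1))"
    using End_On_D(1)[OF \<theta>] by (intro trunc_id[symmetric]) simp
  also have "trunc n (smult c (\<theta> 1)) + (trunc n ([:0, 1:] * (f * \<theta> 1 - pderiv f * h)) - trunc n (h * f))
      = trunc n (pCons c f * \<theta> 1 - pderiv (pCons c f) * h)"
    unfolding trunc_simps[symmetric]
    by (rule arg_cong[of _ _ "trunc n"]) (simp add: pderiv_pCons algebra_simps)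
  finally show ?case .
qed

definition symb :: "nat \<Rightarrow> nat \<Rightarrow> 'a::field_char_0 op \<Rightarrow> 'a poly" where
  "symb n p \<delta> = dpow n p \<delta> 1"

lemma symb_On: "\<delta> \<in> End_On n \<Longrightarrow> symb n p \<delta> \<in> On n"
  unfolding symb_def by (intro End_On_D(1)[OF End_On_dpow]) simp_all

lemma dpow_eq_mult_symb:
  assumes "\<delta> \<in> adnil n (Suc p)" "u \<in> On n"
  shows "dpow n p \<delta> u = trunc n (symb n p \<delta> * u)"
proof -
  have "adx n (dpow n p \<delta>) v = trunc n (0 * v)" if "v \<in> On n" for v
    using dpow_eq_0[OF assms(1) order.refl that] by (simp flip: dpow_Suc)
  from first_order_operator[OF End_On_dpow[OF adnil_End[OF assms(1)]] this assms(2)]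
  show ?thesis by (simp add: symb_def mult.commute)
qed

lemma symb_eq_0_iff:
  assumes "\<delta> \<in> adnil n (Suc p)"
  shows "symb n p \<delta> = 0 \<longleftrightarrow> \<delta> \<in> adnil n p"
proof
  assume "symb n p \<delta> = 0"
  then show "\<delta> \<in> adnil n p"
    using adnil_End[OF assms] by (simp add: adnil_iff_dpow dpow_eq_mult_symb[OF assms])
next
  assume "\<delta> \<in> adnil n p"
  then show "symb n p \<delta> = 0" by (simp add: adnil_iff_dpow symb_def)
qed

lemma symb_linear:
  "symb n p (\<lambda>u. \<delta> u + \<epsilon> u) = symb n p \<delta> + symb n p \<epsilon>"
  "symb n p (\<lambda>u. \<delta> u - \<epsilon> u) = symb n p \<delta> - symb n p \<epsilon>"
  "symb n p (\<lambda>u. smult c (\<delta> u)) = smult c (symb n p \<delta>)"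
  "symb n p (\<lambda>u. 0) = 0"
  by (simp_all add: symb_def dpow_def adx_pow_linear smult_add_right smult_diff_right mult.commute)

lemma symb_eq_iff:
  assumes "\<delta> \<in> adnil n (Suc p)" "\<epsilon> \<in> adnil n (Suc p)"
  shows "(\<lambda>u. \<delta> u - \<epsilon> u) \<in> adnil n p \<longleftrightarrow> symb n p \<delta> = symb n p \<epsilon>"
  using symb_eq_0_iff[OF adnil_diff[OF assms]] by (simp add: symb_linear)

lemma adnil_sum:
  assumes "\<And>i. i \<in> I \<Longrightarrow> \<delta> i \<in> adnil n p"
  shows "(\<lambda>u. \<Sum>i\<in>I. \<delta> i u) \<in> adnil n p"
  using assms
  by (induction I rule: infinite_finite_induct) (simp_all add: adnil_zero adnil_add)

lemma symb_sum: "symb n p (\<lambda>u. \<Sum>i\<in>I. \<delta> i u) = (\<Sum>i\<in>I. symb n p (\<delta> i))"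
  by (induction I rule: infinite_finite_induct) (simp_all add: symb_linear)

lemma dpow_dpow_eq_0:
  assumes \<delta>: "\<delta> \<in> adnil n (Suc p)" and \<epsilon>: "\<epsilon> \<in> adnil n (Suc q)"
    and u: "u \<in> On n" and ij: "i > p \<or> j > q"
  shows "dpow n i \<delta> (dpow n j \<epsilon> u) = 0"
proof (cases "i > p")
  case True
  then show ?thesis
    using End_On_D(1)[OF End_On_dpow[OF adnil_End[OF \<epsilon>]] u] by (intro dpow_eq_0[OF \<delta>]) auto
next
  case False
  with ij u have "dpow n j \<epsilon> u = 0" by (intro dpow_eq_0[OF \<epsilon>]) auto
  then show ?thesis using End_On_D(5)[OF End_On_dpow[OF adnil_End[OF \<delta>]]] by simp
qed

lemma symb_comp:
  assumes \<delta>: "\<delta> \<in> adnil n (Suc p)" and \<epsilon>: "\<epsilon> \<in> adnil n (Suc q)"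
  shows "(\<lambda>u. \<delta> (\<epsilon> u)) \<in> adnil n (Suc (p + q))" (is "?c \<in> _")
    and "symb n (p + q) (\<lambda>u. \<delta> (\<epsilon> u)) = trunc n (symb n p \<delta> * symb n q \<epsilon>)"
proof -
  have E: "\<delta> \<in> End_On n" "\<epsilon> \<in> End_On n" using \<delta> \<epsilon> adnil_End by blast+
  note z = dpow_dpow_eq_0[OF \<delta> \<epsilon>]
  have "dpow n (Suc (p + q)) ?c u = 0" if "u \<in> On n" for u
    unfolding dpow_comp[OF E that] by (intro sum.neutral ballI z that) auto
  then show "?c \<in> adnil n (Suc (p + q))"
    using End_On_comp[OF E] by (simp add: adnil_iff_dpow)
  have "symb n (p + q) ?c = (\<Sum>i\<le>p + q. dpow n i \<delta> (dpow n (p + q - i) \<epsilon> 1))"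
    unfolding symb_def by (rule dpow_comp[OF E]) simp
  also have "\<dots> = (\<Sum>i\<in>{p}. dpow n i \<delta> (dpow n (p + q - i) \<epsilon> 1))"
    by (intro sum.mono_neutral_right ballI z) auto
  also have "\<dots> = dpow n p \<delta> (symb n q \<epsilon>)" by (simp add: symb_def)
  also have "\<dots> = trunc n (symb n p \<delta> * symb n q \<epsilon>)"
    by (intro dpow_eq_mult_symb \<delta> symb_On E)
  finally show "symb n (p + q) ?c = trunc n (symb n p \<delta> * symb n q \<epsilon>)" .
qed

lemma symb_comp_pred:
  assumes \<delta>: "\<delta> \<in> adnil n (Suc a)" and \<epsilon>: "\<epsilon> \<in> adnil n (Suc b)" and p: "a + b = Suc p"
  defines "\<delta>' \<equiv> if a = 0 then 0 else symb n (a - 1) \<delta>"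
    and "\<epsilon>' \<equiv> if b = 0 then 0 else symb n (b - 1) \<epsilon>"
  shows "symb n p (\<lambda>u. \<delta> (\<epsilon> u)) = trunc n (symb n a \<delta> * \<epsilon>' + \<delta>' * symb n b \<epsilon>
           - smult (of_nat a) (symb n a \<delta> * pderiv (symb n b \<epsilon>)))"
proof -
  have E: "\<delta> \<in> End_On n" "\<epsilon> \<in> End_On n" using \<delta> \<epsilon> adnil_End by blast+
  define T where "T = (\<lambda>i. dpow n i \<delta> (dpow n (p - i) \<epsilon> 1))"
  have eq: "symb n p (\<lambda>u. \<delta> (\<epsilon> u)) = (\<Sum>i\<le>p. T i)"
    unfolding symb_def T_def by (rule dpow_comp[OF E]) simp
  have T0: "T i = 0" if "i > a \<or> p - i > b" for i
    unfolding T_def using that by (intro dpow_dpow_eq_0[OF \<delta> \<epsilon>]) auto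
  have Ta: "T a = trunc n (symb n a \<delta> * \<epsilon>')" if "b > 0"
  proof -
    have "T a = dpow n a \<delta> (symb n (b - 1) \<epsilon>)"
      using p that by (simp add: T_def symb_def) (metis Suc_pred add_Suc_right diff_add_inverse diff_Suc_1)
    then show ?thesis using that by (simp add: dpow_eq_mult_symb[OF \<delta> symb_On[OF E(2)]] \<epsilon>'_def)
  qed
  have Ta1: "T a' = trunc n (\<delta>' * symb n b \<epsilon> - smult (of_nat a) (symb n a \<delta> * pderiv (symb n b \<epsilon>)))"
    if a: "a = Suc a'" for a'
  proof -
    have "T a' = dpow n a' \<delta> (symb n b \<epsilon>)"
    proof -
      have "p - a' = b" using p a by simp
      then show ?thesis by (simp add: T_def symb_def)
    qed
    also have "\<dots> = trunc n (symb n b \<epsilon> * dpow n a' \<delta> 1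
        - pderiv (symb n b \<epsilon>) * smult (of_nat a) (symb n a \<delta>))"
    proof (rule first_order_operator[OF End_On_dpow[OF E(1)] _ symb_On[OF E(2)]])
      fix v :: "'a poly" assume v: "v \<in> On n"
      have "adx n (dpow n a' \<delta>) v = smult (of_nat a) (dpow n a \<delta> v)"
        unfolding a by (rule dpow_Suc[symmetric])
      then show "adx n (dpow n a' \<delta>) v = trunc n (smult (of_nat a) (symb n a \<delta>) * v)"
        by (simp add: dpow_eq_mult_symb[OF \<delta> v] trunc_simps)
    qed
    finally show ?thesis using a by (simp add: \<delta>'_def symb_def mult.commute)
  qed
  show ?thesis
  proof (cases a)
    case 0
    have "(\<Sum>i\<le>p. T i) = (\<Sum>i\<in>{0}. T i)"
      using 0 by (intro sum.mono_neutral_right ballI T0) auto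
    with 0 p Ta show ?thesis by (simp add: eq \<delta>'_def)
  next
    case (Suc a')
    show ?thesis
    proof (cases "b = 0")
      case True
      have "(\<Sum>i\<le>p. T i) = (\<Sum>i\<in>{a'}. T i)"
        using Suc p True by (intro sum.mono_neutral_right ballI T0) auto
      with True show ?thesis by (simp add: eq \<epsilon>'_def Ta1[OF Suc])
    next
      case False
      have "(\<Sum>i\<le>p. T i) = (\<Sum>i\<in>{a', a}. T i)"
        using Suc p False by (intro sum.mono_neutral_right ballI T0) auto
      also have "\<dots> = T a' + T a" using Suc by simp
      finally show ?thesis
        using False by (simp only: eq Ta1[OF Suc] Ta neq0_conv) (simp add: trunc_simps)
    qed
  qed
qed

lemma symb_commutator:
  assumes \<delta>: "\<delta> \<in> adnil n (Suc a)" and \<epsilon>: "\<epsilon> \<in> adnil n (Suc b)" and p: "a + b = Suc p"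
  shows "(\<lambda>u. \<delta> (\<epsilon> u) - \<epsilon> (\<delta> u)) \<in> adnil n (Suc p)"
    and "symb n p (\<lambda>u. \<delta> (\<epsilon> u) - \<epsilon> (\<delta> u)) =
      trunc n (smult (of_nat b) (pderiv (symb n a \<delta>) * symb n b \<epsilon>)
        - smult (of_nat a) (symb n a \<delta> * pderiv (symb n b \<epsilon>)))"
proof -
  have p': "b + a = Suc p" using p by simp
  have mem: "(\<lambda>u. \<delta> (\<epsilon> u)) \<in> adnil n (Suc (Suc p))" "(\<lambda>u. \<epsilon> (\<delta> u)) \<in> adnil n (Suc (Suc p))"
    using symb_comp(1)[OF \<delta> \<epsilon>] symb_comp(1)[OF \<epsilon> \<delta>] unfolding p p' .
  have "symb n (Suc p) (\<lambda>u. \<delta> (\<epsilon> u)) = symb n (Suc p) (\<lambda>u. \<epsilon> (\<delta> u))"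
    using symb_comp(2)[OF \<delta> \<epsilon>] symb_comp(2)[OF \<epsilon> \<delta>] unfolding p p' by (simp add: mult.commute)
  then show "(\<lambda>u. \<delta> (\<epsilon> u) - \<epsilon> (\<delta> u)) \<in> adnil n (Suc p)"
    using symb_eq_iff[OF mem] by simp
  show "symb n p (\<lambda>u. \<delta> (\<epsilon> u) - \<epsilon> (\<delta> u)) =
      trunc n (smult (of_nat b) (pderiv (symb n a \<delta>) * symb n b \<epsilon>)
        - smult (of_nat a) (symb n a \<delta> * pderiv (symb n b \<epsilon>)))"
    unfolding symb_linear(2) symb_comp_pred[OF \<delta> \<epsilon> p] symb_comp_pred[OF \<epsilon> \<delta> p'] trunc_simps(2)[symmetric]
    by (rule arg_cong[of _ _ "trunc n"]) (simp add: algebra_simps)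
qed

lemma mulop_adnil: "mulop n f \<in> adnil n (Suc 0)"
  unfolding adnil_Suc by (simp add: End_On_mulop adnil_def End_On_adx adx_apply mulop_commute)

lemma symb_mulop: "symb n 0 (mulop n f) = trunc n f"
  by (simp add: symb_def mulop_def)

lemma id_adnil: "(\<lambda>u. u) \<in> adnil n (Suc 0)"
  by (simp add: adnil_Suc End_On_id adnil_def End_On_adx adx_apply)

lemma symb_funpow:
  assumes "\<delta> \<in> adnil n (Suc p)"
  shows "\<delta> ^^ m \<in> adnil n (Suc (p * m))" and "symb n (p * m) (\<delta> ^^ m) = trunc n (symb n p \<delta> ^ m)"
proof -
  have "\<delta> ^^ m \<in> adnil n (Suc (p * m)) \<and> symb n (p * m) (\<delta> ^^ m) = trunc n (symb n p \<delta> ^ m)"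
  proof (induction m)
    case 0
    show ?case using id_adnil[of n] by (simp add: symb_def trunc_id id_def)
  next
    case (Suc m)
    have "\<delta> ^^ Suc m = (\<lambda>u. \<delta> ((\<delta> ^^ m) u))" by (simp add: fun_eq_iff)
    with Suc symb_comp[OF assms conjunct1[OF Suc.IH]] show ?case
      by (simp add: mod_mult_right_eq)
  qed
  then show "\<delta> ^^ m \<in> adnil n (Suc (p * m))" "symb n (p * m) (\<delta> ^^ m) = trunc n (symb n p \<delta> ^ m)"
    by blast+
qed

section \<open>The symbols of the generators\<close>

lemma coeff_Y1: "coeff (Y1 n w) k = (of_nat n / 2 - of_nat k) * coeff w k"
  by (cases k) (simp_all add: Y1_def coeff_pderiv algebra_simps)

lemma coeff_Y2: "coeff (Y2 n w) k = of_nat (Suc k) * (of_nat k - of_nat n) * coeff w (Suc k)"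
  by (cases k) (simp_all add: Y2_def coeff_pderiv algebra_simps)

lemma Y1_trunc: "Y1 n (trunc n w) = trunc n (Y1 n w)"
  by (rule poly_eqI) (simp add: coeff_Y1 coeff_trunc)

lemma Y2_trunc: "Y2 n (trunc n w) = trunc n (Y2 n w)"
proof (rule poly_eqI)
  fix k
  show "coeff (Y2 n (trunc n w)) k = coeff (trunc n (Y2 n w)) k"
    by (cases "k = n") (simp_all add: coeff_Y2 coeff_trunc del: of_nat_Suc)
qed

lemma End_On_Y1: "Y1 n \<in> End_On n"
  by (rule End_On_I)
    (simp_all add: On_coeff coeff_Y1 poly_eq_iff algebra_simps)

lemma End_On_Y2: "Y2 n \<in> End_On n"
  by (rule End_On_I)
    (simp_all add: On_coeff coeff_Y2 poly_eq_iff algebra_simps)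

lemma adx_Y1: "u \<in> On n \<Longrightarrow> adx n (Y1 n) u = mulop n [:0, 1:] u"
  unfolding adx_apply mulop_def Y1_trunc trunc_simps(2)[symmetric]
  by (rule arg_cong[of _ _ "trunc n"])
    (simp add: Y1_def pderiv_pCons pderiv_add algebra_simps)

lemma adx_Y2: assumes "u \<in> On n" shows "adx n (Y2 n) u = smult 2 (Y1 n u)"
proof -
  have "adx n (Y2 n) u = trunc n ([:0, 1:] * Y2 n u - Y2 n ([:0, 1:] * u))"
    by (simp only: adx_apply mulop_def Y2_trunc trunc_simps)
  also have "[:0, 1:] * Y2 n u - Y2 n ([:0, 1:] * u) = smult 2 (Y1 n u)"
  proof (rule poly_eqI)
    fix k
    show "coeff ([:0, 1:] * Y2 n u - Y2 n ([:0, 1:] * u)) k = coeff (smult 2 (Y1 n u)) k"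
      by (cases k) (simp_all add: coeff_Y1 coeff_Y2 algebra_simps)
  qed
  also have "trunc n (smult 2 (Y1 n u)) = smult 2 (Y1 n u)"
    by (intro trunc_id On_closed End_On_D(1)[OF End_On_Y1] assms)
  finally show ?thesis .
qed

lemma symb_Suc:
  assumes \<epsilon>: "\<epsilon> \<in> End_On n" and \<delta>: "\<delta> \<in> adnil n (Suc p)"
    and eq: "\<And>u. u \<in> On n \<Longrightarrow> adx n \<epsilon> u = smult (of_nat (Suc p)) (\<delta> u)"
  shows "\<epsilon> \<in> adnil n (Suc (Suc p))" and "symb n (Suc p) \<epsilon> = symb n p \<delta>"
proof -
  have "adx n \<epsilon> \<in> adnil n (Suc p)"
    by (rule adnil_cong[OF eq[symmetric] End_On_adx[OF \<epsilon>] adnil_smult[OF \<delta>]])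
  then show "\<epsilon> \<in> adnil n (Suc (Suc p))"
    using \<epsilon> by (subst adnil_Suc) blast
  have "(adx n ^^ Suc p) \<epsilon> 1 = (adx n ^^ p) (adx n \<epsilon>) 1"
    by (simp only: funpow_Suc_right comp_apply)
  also have "\<dots> = (adx n ^^ p) (\<lambda>u. smult (of_nat (Suc p)) (\<delta> u)) 1"
    by (rule adx_pow_cong[OF eq]) simp_all
  also have "\<dots> = smult (of_nat (Suc p)) ((adx n ^^ p) \<delta> 1)"
    by (simp only: adx_pow_linear)
  finally have "symb n (Suc p) \<epsilon> = smult (inverse (fact (Suc p)) * of_nat (Suc p)) ((adx n ^^ p) \<delta> 1)"
    by (simp only: symb_def dpow_def smult_smult)
  also have "inverse (fact (Suc p)) * of_nat (Suc p) = (inverse (fact p) :: 'a)"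
    by (simp add: field_simps del: of_nat_Suc)
  finally show "symb n (Suc p) \<epsilon> = symb n p \<delta>"
    by (simp only: symb_def dpow_def)
qed

lemma Y0_symb: "Y0 n \<in> adnil n (Suc 0)" "symb n 0 (Y0 n) = trunc n [:0, 1:]"
  by (simp_all add: Y0_def mulop_adnil symb_mulop)

lemma Y1_symb: "(Y1 n :: 'a::field_char_0 op) \<in> adnil n (Suc 1)" "symb n 1 (Y1 n) = trunc n [:0, 1 :: 'a:]"
proof -
  have eq: "adx n (Y1 n) u = smult (of_nat (Suc 0)) (Y0 n u)" if "u \<in> On n" for u :: "'a poly"
    using adx_Y1[OF that] by (simp add: Y0_def)
  from symb_Suc[OF End_On_Y1 Y0_symb(1) eq]
  show "(Y1 n :: 'a op) \<in> adnil n (Suc 1)" "symb n 1 (Y1 n) = trunc n [:0, 1 :: 'a:]"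
    by (simp_all add: Y0_symb(2))
qed

lemma Y2_symb: "(Y2 n :: 'a::field_char_0 op) \<in> adnil n (Suc 2)" "symb n 2 (Y2 n) = trunc n [:0, 1 :: 'a:]"
proof -
  have eq: "adx n (Y2 n) u = smult (of_nat (Suc 1)) (Y1 n u)" if "u \<in> On n" for u :: "'a poly"
    using adx_Y2[OF that] by simp
  from symb_Suc[OF End_On_Y2 Y1_symb(1) eq]
  show "(Y2 n :: 'a op) \<in> adnil n (Suc 2)" "symb n 2 (Y2 n) = trunc n [:0, 1 :: 'a:]"
    by (simp_all add: Y1_symb(2) numeral_2_eq_2 del: One_nat_def)
qed

lemma monomial_operator_symb:
  defines "M \<equiv> \<lambda>n a b c. (Y0 n ^^ a) \<circ> (Y1 n ^^ b) \<circ> (Y2 n ^^ c)"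
  shows "M n a b c \<in> adnil n (Suc (b + 2 * c))"
    and "symb n (b + 2 * c) (M n a b c) = trunc n (monom 1 (a + b + c))"
proof -
  note c = symb_comp(1)[OF symb_funpow(1)[OF Y1_symb(1), of b] symb_funpow(1)[OF Y2_symb(1), of c]]
    symb_comp(2)[OF symb_funpow(1)[OF Y1_symb(1), of b] symb_funpow(1)[OF Y2_symb(1), of c]]
  note d = symb_comp(1)[OF symb_funpow(1)[OF Y0_symb(1), of a] c(1)]
    symb_comp(2)[OF symb_funpow(1)[OF Y0_symb(1), of a] c(1)]
  have eq: "M n a b c = (\<lambda>u. (Y0 n ^^ a) ((Y1 n ^^ b) ((Y2 n ^^ c) u)))"
    by (simp add: M_def fun_eq_iff)
  show "M n a b c \<in> adnil n (Suc (b + 2 * c))"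
    using d(1) by (simp add: eq)
  have "symb n (b + 2 * c) (M n a b c) = trunc n ([:0, 1:] ^ (a + b + c))"
    using d(2) unfolding c(2) symb_funpow(2)[OF Y0_symb(1)] symb_funpow(2)[OF Y1_symb(1)]
      symb_funpow(2)[OF Y2_symb(1)] Y0_symb(2) Y1_symb(2) Y2_symb(2)
    by (simp add: eq power_mod mod_mult_left_eq mod_mult_right_eq power_add mult.assoc
        del: mult_pCons_left mult_pCons_right)
  then show "symb n (b + 2 * c) (M n a b c) = trunc n (monom 1 (a + b + c))"
    by (simp add: monom_altdef)
qed

section \<open>The trace form\<close>

definition tr :: "nat \<Rightarrow> 'a::field_char_0 op \<Rightarrow> 'a" where
  "tr n \<delta> = (\<Sum>k\<le>n. coeff (\<delta> (monom 1 k)) k)"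

lemma monom_On: "k \<le> n \<Longrightarrow> monom c k \<in> On n"
  by (simp add: On_coeff)

lemma tr_adx:
  assumes "\<delta> \<in> End_On n"
  shows "tr n (adx n \<delta>) = 0"
proof -
  have L: "coeff (mulop n [:0, 1:] (\<delta> (monom 1 k))) k
      = (case k of 0 \<Rightarrow> 0 | Suc j \<Rightarrow> coeff (\<delta> (monom 1 (Suc j))) j)" if "k \<le> n" for k
    using that by (cases k) (simp_all add: mulop_def coeff_trunc)
  have x: "mulop n [:0, 1:] (monom (1::'a) k) = (if k < n then monom 1 (Suc k) else 0)" if "k \<le> n" for k
    using that by (intro poly_eqI) (auto simp: mulop_def coeff_trunc coeff_pCons split: nat.split)
  have R: "coeff (\<delta> (mulop n [:0, 1:] (monom 1 k))) k
      = (if k < n then coeff (\<delta> (monom 1 (Suc k))) k else 0)" if "k \<le> n" for k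
    using x[OF that] by (simp add: End_On_D(5)[OF assms])
  show ?thesis
  proof (cases n)
    case 0
    then show ?thesis using L[of 0] R[of 0] by (simp add: tr_def adx_apply)
  next
    case (Suc m)
    have "tr n (adx n \<delta>) = (\<Sum>k\<le>n. coeff (mulop n [:0, 1:] (\<delta> (monom 1 k))) k)
        - (\<Sum>k\<le>n. coeff (\<delta> (mulop n [:0, 1:] (monom 1 k))) k)"
      by (simp add: tr_def adx_apply sum_subtractf)
    also have "(\<Sum>k\<le>n. coeff (mulop n [:0, 1:] (\<delta> (monom 1 k))) k)
        = (\<Sum>k\<le>Suc m. case k of 0 \<Rightarrow> 0 | Suc j \<Rightarrow> coeff (\<delta> (monom 1 (Suc j))) j)"
      using L unfolding Suc by (intro sum.cong) simp_all
    also have "\<dots> = (\<Sum>k\<le>m. coeff (\<delta> (monom 1 (Suc k))) k)"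
      by (subst sum.atMost_Suc_shift) simp
    also have "(\<Sum>k\<le>n. coeff (\<delta> (mulop n [:0, 1:] (monom 1 k))) k)
        = (\<Sum>k\<le>Suc m. if k < n then coeff (\<delta> (monom 1 (Suc k))) k else 0)"
      using R unfolding Suc by (intro sum.cong) simp_all
    also have "\<dots> = (\<Sum>k\<le>m. coeff (\<delta> (monom 1 (Suc k))) k)"
      using Suc by simp
    finally show ?thesis by simp
  qed
qed

lemma tr_adx_pow_comp:
  assumes "\<delta> \<in> End_On n" "\<epsilon> \<in> adnil n p"
  shows "tr n (\<lambda>u. (adx n ^^ p) \<delta> (\<epsilon> u)) = 0"
  using assms(2)
proof (induction p arbitrary: \<epsilon>)
  case 0
  then have "\<epsilon> u = 0" if "u \<in> On n" for u using that by (simp add: adnil_def)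
  then show ?case by (simp add: tr_def monom_On End_On_D(5)[OF assms(1)])
next
  case (Suc p)
  let ?d = "(adx n ^^ p) \<delta>"
  have D: "?d \<in> End_On n" by (rule End_On_adx_pow[OF assms(1)])
  have \<epsilon>: "\<epsilon> \<in> End_On n" "adx n \<epsilon> \<in> adnil n p"
    using Suc.prems by (simp_all add: adnil_Suc)
  have "0 = tr n (adx n (\<lambda>u. ?d (\<epsilon> u)))"
    by (rule tr_adx[OF End_On_comp[OF D \<epsilon>(1)], symmetric])
  also have "\<dots> = tr n (\<lambda>u. adx n ?d (\<epsilon> u)) + tr n (\<lambda>u. ?d (adx n \<epsilon> u))"
    by (simp add: tr_def adx_comp[OF D \<epsilon>(1)] monom_On sum.distrib)
  finally show ?case using Suc.IH[OF \<epsilon>(2)] by simp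
qed

lemma Y2_monom: 
  assumes "k \<le> n"
  shows "Y2 n (monom c k) = monom (- of_nat (k * (Suc n - k)) * c) (k - 1)"
proof (rule poly_eqI)
  fix j
  have "of_nat (k * (Suc n - k)) = of_nat k * (of_nat (Suc n) - of_nat k :: 'a)"
    using assms by (simp add: of_nat_diff)
  then show "coeff (Y2 n (monom c k)) j = coeff (monom (- of_nat (k * (Suc n - k)) * c) (k - 1)) j"
    by (simp only: of_nat_mult) (cases k, auto simp: coeff_Y2 algebra_simps)
qed

lemma Y2_pow_monom:
  assumes "k \<le> n"
  shows "(Y2 n ^^ e) (monom 1 k)
    = monom ((- 1) ^ e * of_nat (\<Prod>i<e. (k - i) * (Suc n - (k - i)))) (k - e)"
proof (induction e)
  case (Suc e)
  have "k - e \<le> n" using assms by simp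
  then show ?case by (simp add: Suc.IH Y2_monom mult.commute mult.left_commute del: of_nat_diff)
qed simp

text \<open>Pair \<open>\<delta>\<close> with the lowering operator \<open>Y2 ^ e\<close>, of order \<open>2 e < p\<close>, under the trace form: all
  diagonal entries of \<open>x^e Y2^e\<close> have the same sign.\<close>

lemma coeff_symb_eq_0:
  assumes \<delta>: "\<delta> \<in> adnil n (Suc p)" and e: "2 * e < p"
  shows "coeff (symb n p \<delta>) e = 0"
proof (cases "e \<le> n")
  case False
  then show ?thesis using symb_On[OF adnil_End[OF \<delta>], of p] by (simp add: On_coeff)
next
  case True
  let ?f = "symb n p \<delta>"
  define N where "N = (\<lambda>k. \<Prod>i<e. (k - i) * (Suc n - (k - i)))"
  have Y: "Y2 n ^^ e \<in> adnil n p"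
    by (rule adnil_mono[OF symb_funpow(1)[OF Y2_symb(1)]]) (use e in simp)
  have "coeff (dpow n p \<delta> ((Y2 n ^^ e) (monom 1 k))) k = (- 1) ^ e * of_nat (N k) * coeff ?f e"
    if k: "k \<le> n" for k
  proof -
    have eq: "(Y2 n ^^ e) (monom 1 k) = monom ((- 1) ^ e * of_nat (N k)) (k - e)"
      by (simp only: Y2_pow_monom[OF k] N_def)
    show ?thesis
    proof (cases "e \<le> k")
      case le: True
      have "(Y2 n ^^ e) (monom 1 k) \<in> On n"
        using k by (simp add: eq monom_On)
      from dpow_eq_mult_symb[OF \<delta> this] show ?thesis
        using k le by (simp add: coeff_trunc eq mult.commute[of ?f] coeff_monom_mult)
    next
      case False
      then have "N k = 0" by (auto simp: N_def)
      then have "(Y2 n ^^ e) (monom (1::'a) k) = 0"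
        by (simp add: eq)
      with \<open>N k = 0\<close> show ?thesis
        by (simp add: End_On_D(5)[OF End_On_dpow[OF adnil_End[OF \<delta>]]])
    qed
  qed
  then have "tr n (\<lambda>u. dpow n p \<delta> ((Y2 n ^^ e) u)) = (\<Sum>k\<le>n. (- 1) ^ e * of_nat (N k) * coeff ?f e)"
    unfolding tr_def by (intro sum.cong) simp_all
  moreover have "tr n (\<lambda>u. dpow n p \<delta> ((Y2 n ^^ e) u)) = 0"
    using tr_adx_pow_comp[OF adnil_End[OF \<delta>] Y]
    by (simp add: tr_def dpow_def flip: sum_distrib_left)
  ultimately have "(- 1) ^ e * of_nat (\<Sum>k\<le>n. N k) * coeff ?f e = 0"
    by (simp add: sum_distrib_left sum_distrib_right)
  moreover have "(\<Sum>k\<le>n. N k) \<noteq> 0"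
  proof -
    have "N n \<noteq> 0" using True by (auto simp: N_def)
    then show ?thesis using member_le_sum[of n "{..n}" N] by (metis atMost_iff finite_atMost le_zero_eq order.refl zero_le)
  qed
  ultimately show ?thesis by (simp del: of_nat_sum)
qed

section \<open>The homomorphism to \<open>k[x][\<xi>]\<close>\<close>

definition sigma1 :: "'a::idom poly poly \<Rightarrow> 'a poly poly" where
  "sigma1 G = pcompose G [:0, [:0, 1:]:]"

definition sigma :: "'a::idom mpoly3 \<Rightarrow> 'a poly poly" where
  "sigma F = poly (map_poly sigma1 F) [:0, 0, [:0, 1:]:]"

lemma sigma1_simps:
  "sigma1 0 = 0"
  "sigma1 (pCons H G) = [:H:] + [:0, [:0, 1:]:] * sigma1 G"
  "sigma1 (G + G') = sigma1 G + sigma1 G'"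
  "sigma1 (G * G') = sigma1 G * sigma1 G'"
  by (simp_all only: sigma1_def pcompose_0 pcompose_pCons pcompose_add pcompose_mult)

lemma sigma_0 [simp]: "sigma 0 = 0"
  by (simp add: sigma_def)

lemma sigma_pCons: "sigma (pCons G F) = sigma1 G + [:0, 0, [:0, 1:]:] * sigma F"
  by (simp only: sigma_def map_poly_pCons[of sigma1, OF sigma1_simps(1)] poly_pCons)

lemma sigma_add: "sigma (F + G) = sigma F + sigma G"
proof (induction F G rule: poly_induct2)
  case (pCons H F H' G)
  then show ?case
    by (simp only: add_pCons sigma_pCons sigma1_simps) (simp only: algebra_simps)
qed simp

lemma sigma_smult: "sigma (smult G F) = sigma1 G * sigma F"
proof (induction F)
  case (pCons H F)
  then show ?case
    by (simp only: smult_pCons sigma_pCons sigma1_simps) (simp only: algebra_simps)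
qed simp

lemma sigma_mult: "sigma (F * G) = sigma F * sigma G"
proof (induction F)
  case (pCons H F)
  define q where "q = ([:0, 0, [:0, 1:]:] :: 'a poly poly)"
  show ?case
    by (simp only: mult_pCons_left sigma_add sigma_smult sigma_pCons[where ?'a = 'a, folded q_def] pCons.IH
        sigma1_simps(1) add_0 distrib_right mult.assoc)
qed simp

lemma sigma_diff: "sigma (F - G) = sigma F - sigma G"
  using sigma_add[of "F - G" G] by (simp add: algebra_simps)

lemma sigma_sum: "sigma (sum f I) = (\<Sum>i\<in>I. sigma (f i))"
  by (induction I rule: infinite_finite_induct) (simp_all add: sigma_add)

lemma sigma_const: "sigma [:[:H:]:] = [:H:]"
  by (simp add: sigma_pCons sigma1_simps)

lemma sigma_1: "sigma 1 = 1"
  using sigma_const[of 1] by (simp add: one_pCons)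

lemma sigma_power: "sigma (F ^ m) = sigma F ^ m"
  by (induction m) (simp_all add: sigma_1 sigma_mult)

lemma sigma_vars:
  "sigma z0 = monom (monom 1 1) 0" "sigma z1 = monom (monom 1 1) 1" "sigma z2 = monom (monom 1 1) 2"
  by (simp_all add: z0_def z1_def z2_def sigma_pCons sigma1_simps monom_altdef one_pCons
      power2_eq_square)

lemma monom_power': "monom r i ^ m = monom (r ^ m) (i * m)"
  for r :: "'b::comm_semiring_1"
  by (induction m) (simp_all add: mult_monom)

lemma sigma_monomial3: "sigma (monomial3 a b c) = monom (monom 1 (a + b + c)) (b + 2 * c)"
  by (simp add: monomial3_def sigma_mult sigma_power sigma_vars monom_power' mult_monom)

lemma map_poly_pderiv_pCons [simp]:
  "map_poly pderiv (pCons a P) = pCons (pderiv a) (map_poly pderiv P)"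
  by (simp add: map_poly_pCons)

lemma map_poly_map_poly_pderiv_pCons [simp]:
  "map_poly (map_poly pderiv) (pCons a P) = pCons (map_poly pderiv a) (map_poly (map_poly pderiv) P)"
  by (simp add: map_poly_pCons)

lemma map_poly_pderiv_add: "map_poly pderiv (P + Q) = map_poly pderiv P + map_poly pderiv Q"
  by (rule poly_eqI) (simp add: coeff_map_poly pderiv_add)

lemma map_poly_pderiv_smult:
  "map_poly pderiv (smult a P) = smult (pderiv a) P + smult a (map_poly pderiv P)"
  by (rule poly_eqI) (simp add: coeff_map_poly pderiv_mult algebra_simps)

lemma map_poly_pderiv_mult:
  "map_poly pderiv (P * Q) = map_poly pderiv P * Q + P * map_poly pderiv Q"
  by (induction P) (simp_all add: map_poly_pderiv_add map_poly_pderiv_smult algebra_simps)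

lemma chain_rule_sigma1:
  "map_poly pderiv (sigma1 G) = sigma1 (map_poly pderiv G) + [:0, 1:] * sigma1 (pderiv G)"
  "pderiv (sigma1 G) = [:[:0, 1:]:] * sigma1 (pderiv G)"
proof -
  define y where "y = ([:0, 1:] :: 'a poly poly)"
  define q where "q = ([:0, [:0, 1:]:] :: 'a poly poly)"
  have e: "map_poly pderiv q = y" "map_poly pderiv [:H:] = [:pderiv H:]" for H :: "'a poly"
    by (simp_all add: q_def y_def one_pCons pderiv_pCons)
  have S: "sigma1 0 = (0 :: 'a poly poly)" "sigma1 (pCons H G) = [:H:] + q * sigma1 G" for H G
    by (simp_all only: sigma1_simps q_def)
  have "map_poly pderiv (sigma1 G) = sigma1 (map_poly pderiv G) + y * sigma1 (pderiv G)"
  proof (induction G)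
    case (pCons H G)
    show ?case
      by (simp only: S sigma1_simps(3) map_poly_pderiv_add map_poly_pderiv_mult e map_poly_pderiv_pCons
          pderiv_pCons pCons.IH pCons_0_0 add_0) (simp add: algebra_simps)
  qed (simp add: S)
  then show "map_poly pderiv (sigma1 G) = sigma1 (map_poly pderiv G) + [:0, 1:] * sigma1 (pderiv G)"
    by (simp only: y_def)
  show "pderiv (sigma1 G) = [:[:0, 1:]:] * sigma1 (pderiv G)"
    by (simp add: sigma1_def pderiv_pcompose pderiv_pCons mult.commute)
qed

lemma chain_rule_sigma:
  defines "x \<equiv> [:[:0, 1:]:] :: 'a::idom poly poly" and "y \<equiv> [:0, 1:]"
  shows "map_poly pderiv (sigma F) = sigma (d0 F) + y * sigma (d1 F) + y\<^sup>2 * sigma (d2 F)"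
    and "pderiv (sigma F) = x * sigma (d1 F) + 2 * x * y * sigma (d2 F)"
proof -
  define q where "q = ([:0, 0, [:0, 1:]:] :: 'a poly poly)"
  have "map_poly pderiv q = y\<^sup>2" "pderiv q = (x + x) * y"
    by (simp_all add: q_def x_def y_def one_pCons pderiv_pCons power2_eq_square)
  then have e: "map_poly pderiv q = y\<^sup>2" "pderiv q = 2 * x * y"
    by (simp_all only: mult_2)
  note S = sigma_pCons[where ?'a = 'a, folded q_def]
  show "map_poly pderiv (sigma F) = sigma (d0 F) + y * sigma (d1 F) + y\<^sup>2 * sigma (d2 F)"
  proof (induction F)
    case (pCons G F)
    then show ?case
      by (simp only: d0_def d1_def d2_def map_poly_pderiv_pCons map_poly_map_poly_pderiv_pCons
          pderiv_pCons S sigma_add sigma1_simps(1) chain_rule_sigma1[where ?'a = 'a, folded y_def]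
          map_poly_pderiv_add map_poly_pderiv_mult e)
        (simp add: algebra_simps)
  qed (simp add: d0_def d1_def d2_def)
  show "pderiv (sigma F) = x * sigma (d1 F) + 2 * x * y * sigma (d2 F)"
  proof (induction F)
    case (pCons G F)
    then show ?case
      by (simp only: d1_def d2_def map_poly_pderiv_pCons
          pderiv_pCons S sigma_add sigma1_simps(1) chain_rule_sigma1[where ?'a = 'a, folded x_def]
          pderiv_add pderiv_mult e)
        (simp add: algebra_simps)
  qed (simp add: d1_def d2_def)
qed

lemma sigma_pbracket:
  "sigma (pbracket F G) = map_poly pderiv (sigma F) * pderiv (sigma G)
     - pderiv (sigma F) * map_poly pderiv (sigma G)"
proof -
  define x where "x = ([:[:0, 1:]:] :: 'a poly poly)"
  define y where "y = ([:0, 1:] :: 'a poly poly)"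
  have "sigma z0 = x" "sigma z1 = x * y" "sigma z2 = x * y\<^sup>2"
    by (simp_all add: x_def y_def sigma_vars monom_altdef one_pCons power2_eq_square)
  then have e: "sigma z0 = x" "sigma (2 * z1) = 2 * x * y" "sigma z2 = x * y\<^sup>2"
    by (simp_all only: mult_2 sigma_add distrib_right)
  show ?thesis
    unfolding pbracket_def chain_rule_sigma[where ?'a = 'a, folded x_def y_def]
    by (simp only: sigma_add sigma_diff sigma_mult[of _ z0] sigma_mult[of _ z2]
        sigma_mult[of _ "2 * z1"] sigma_mult[of "d0 _"] sigma_mult[of "d1 _"] sigma_mult[of "d2 _"] e)
      (simp add: algebra_simps power2_eq_square)
qed

lemma bounded_coeffs:
  assumes "f 0 = (0::nat)"
  shows "\<exists>M. \<forall>i. f (coeff P i) \<le> M"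
proof (intro exI allI)
  fix i
  show "f (coeff P i) \<le> (\<Sum>j\<le>degree P. f (coeff P j))"
  proof (cases "i \<le> degree P")
    case True
    then show ?thesis by (intro member_le_sum) auto
  next
    case False
    then show ?thesis using assms by (simp add: coeff_eq_0)
  qed
qed

definition degrees_le :: "nat \<Rightarrow> 'a::idom mpoly3 \<Rightarrow> bool" where
  "degrees_le M F \<longleftrightarrow> degree F \<le> M \<and> (\<forall>c. degree (coeff F c) \<le> M)
     \<and> (\<forall>c b. degree (coeff (coeff F c) b) \<le> M)"

lemma degrees_le_exists: "\<exists>M\<ge>m. degrees_le M F"
proof -
  obtain M1 where M1: "\<And>c. degree (coeff F c) \<le> M1"
    using bounded_coeffs[of degree F] by auto
  define f where "f = (\<lambda>G :: 'a poly poly. LEAST M. \<forall>b. degree (coeff G b) \<le> M)"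
  have f: "degree (coeff G b) \<le> f G" for G b
    using LeastI_ex[OF bounded_coeffs[of degree G]] unfolding f_def by simp
  have "f 0 = 0" unfolding f_def by (rule Least_eq_0) simp
  then obtain M2 where "\<And>c. f (coeff F c) \<le> M2"
    using bounded_coeffs[of f F] by auto
  then have M2: "degree (coeff (coeff F c) b) \<le> M2" for c b
    using f order.trans by blast
  define M where "M = Max {m, degree F, M1, M2}"
  have "m \<le> M" "degree F \<le> M" "M1 \<le> M" "M2 \<le> M"
    by (simp_all add: M_def)
  then show ?thesis
    using M1 M2 order.trans unfolding degrees_le_def by blast
qed

abbreviation coeff3 :: "'a::idom mpoly3 \<Rightarrow> nat \<Rightarrow> nat \<Rightarrow> nat \<Rightarrow> 'a" where
  "coeff3 F a b c \<equiv> coeff (coeff (coeff F c) b) a"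

abbreviation const3 :: "'a::idom \<Rightarrow> 'a mpoly3" where
  "const3 r \<equiv> [:[:[:r:]:]:]"

lemma monom_sum: "monom (sum f I) i = (\<Sum>j\<in>I. monom (f j) i)"
  by (rule poly_eqI) (simp add: coeff_sum)

lemma const3_mult_monomial3:
  "const3 r * monomial3 a b c = monom (monom (monom r a) b) c"
  by (simp add: monomial3_def z0_def z1_def z2_def monom_altdef power_mult_distrib poly_const_pow
      smult_power ac_simps flip: smult_monom)

lemma mpoly3_decomp:
  assumes "degrees_le M F"
  shows "F = (\<Sum>c\<le>M. \<Sum>b\<le>M. \<Sum>a\<le>M. const3 (coeff3 F a b c) * monomial3 a b c)"
proof -
  have "F = (\<Sum>c\<le>M. monom (coeff F c) c)"
    using assms by (simp add: degrees_le_def poly_as_sum_of_monoms')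
  also have "\<dots> = (\<Sum>c\<le>M. monom (\<Sum>b\<le>M. monom (\<Sum>a\<le>M. monom (coeff3 F a b c) a) b) c)"
    using assms by (simp add: degrees_le_def poly_as_sum_of_monoms')
  also have "\<dots> = (\<Sum>c\<le>M. \<Sum>b\<le>M. \<Sum>a\<le>M. const3 (coeff3 F a b c) * monomial3 a b c)"
    by (simp only: monom_sum const3_mult_monomial3)
  finally show ?thesis .
qed

lemma sigma_const3_monomial3:
  "sigma (const3 r * monomial3 a b c) = monom (monom r (a + b + c)) (b + 2 * c)"
  by (simp only: sigma_mult sigma_monomial3 sigma_const) (simp add: smult_monom)

lemma coeff_sigma:
  assumes "degrees_le M F"
  shows "coeff (sigma F) p
    = (\<Sum>c\<le>M. \<Sum>b\<le>M. if b + 2 * c = p then \<Sum>a\<le>M. monom (coeff3 F a b c) (a + b + c) else 0)"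
  by (subst mpoly3_decomp[OF assms], simp only: sigma_sum coeff_sum sigma_const3_monomial3 coeff_monom)
    (intro sum.cong refl, simp)

lemma coeff_coeff_sigma_eq_0:
  assumes "2 * d < p"
  shows "coeff (coeff (sigma F) p) d = 0"
proof -
  obtain M where M: "degrees_le M F" using degrees_le_exists by blast
  show ?thesis
    using assms unfolding coeff_sigma[OF M] coeff_sum
    by (intro sum.neutral ballI) (auto simp: coeff_sum intro!: sum.neutral)
qed

section \<open>The map on graded elements\<close>

lemma Phi_symb:
  fixes F :: "'a::field_char_0 mpoly3"
  shows "Phi n F p \<in> adnil n (Suc p)" "symb n p (Phi n F p) = trunc n (coeff (sigma F) p)"
proof -
  define A where "A = (\<lambda>c b u. if b + 2 * c = p then
       (\<Sum>a\<le>degree (coeff (coeff F c) b). smult (coeff3 F a b c)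
            (((Y0 n ^^ a) \<circ> (Y1 n ^^ b) \<circ> (Y2 n ^^ c)) u)) else 0)"
  have Phi: "Phi n F p = (\<lambda>u. \<Sum>c\<le>p. \<Sum>b\<le>p. A c b u)"
    unfolding Phi_def A_def by (rule refl)
  obtain M where M: "p \<le> M" "degrees_le M F" using degrees_le_exists by blast
  have A: "A c b \<in> adnil n (Suc p) \<and> symb n p (A c b)
      = trunc n (if b + 2 * c = p then \<Sum>a\<le>M. monom (coeff3 F a b c) (a + b + c) else 0)" for b c
  proof (cases "b + 2 * c = p")
    case True
    let ?D = "degree (coeff (coeff F c) b)"
    have eq: "A c b = (\<lambda>u. \<Sum>a\<le>?D. smult (coeff3 F a b c)
            (((Y0 n ^^ a) \<circ> (Y1 n ^^ b) \<circ> (Y2 n ^^ c)) u))"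
      by (simp only: A_def True refl if_True)
    have "A c b \<in> adnil n (Suc p)"
      unfolding eq True[symmetric] by (intro adnil_sum adnil_smult monomial_operator_symb(1))
    moreover have "symb n p (A c b) = (\<Sum>a\<le>?D. trunc n (monom (coeff3 F a b c) (a + b + c)))"
      unfolding eq True[symmetric] symb_sum symb_linear(3) monomial_operator_symb(2)
        trunc_simps(3)[symmetric]
      by (simp add: smult_monom)
    moreover have "\<dots> = (\<Sum>a\<le>M. trunc n (monom (coeff3 F a b c) (a + b + c)))"
      using M(2) by (intro sum.mono_neutral_left) (auto simp: degrees_le_def coeff_eq_0)
    ultimately show ?thesis
      using True by (simp add: trunc_sum)
  next
    case False
    then have "A c b = (\<lambda>u. 0)" by (simp add: A_def)
    with False show ?thesis by (simp add: adnil_zero symb_linear)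
  qed
  show "Phi n F p \<in> adnil n (Suc p)"
    unfolding Phi by (intro adnil_sum conjunct1[OF A])
  have "symb n p (Phi n F p) = trunc n (\<Sum>c\<le>p. \<Sum>b\<le>p.
      if b + 2 * c = p then \<Sum>a\<le>M. monom (coeff3 F a b c) (a + b + c) else 0)"
    unfolding Phi symb_sum conjunct2[OF A] trunc_sum ..
  also have "(\<Sum>c\<le>p. \<Sum>b\<le>p.
      if b + 2 * c = p then \<Sum>a\<le>M. monom (coeff3 F a b c) (a + b + c) else 0) = coeff (sigma F) p"
  proof -
    have "(\<Sum>b\<le>p. if b + 2 * c = p then \<Sum>a\<le>M. monom (coeff3 F a b c) (a + b + c) else 0)
        = (\<Sum>b\<le>M. if b + 2 * c = p then \<Sum>a\<le>M. monom (coeff3 F a b c) (a + b + c) else 0)" for c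
      using M(1) by (intro sum.mono_neutral_left) auto
    then show ?thesis
      unfolding coeff_sigma[OF M(2)] using M(1)
      by (simp only:) (intro sum.mono_neutral_left ballI sum.neutral, auto)
  qed
  finally show "symb n p (Phi n F p) = trunc n (coeff (sigma F) p)" .
qed

lemma trunc_eq_0_iff: "trunc n f = 0 \<longleftrightarrow> (\<forall>d\<le>n. coeff f d = 0)"
  by (auto simp: poly_eq_iff coeff_trunc)

lemma gr_eq_iff:
  assumes "\<And>p. g p \<in> adnil n (Suc p)" "\<And>p. h p \<in> adnil n (Suc p)"
  shows "gr_eq n g h \<longleftrightarrow> (\<forall>p. symb n p (g p) = symb n p (h p))"
  unfolding gr_eq_def Dord_int symb_eq_iff[OF assms] ..

lemma gr_elem_iff:
  "gr_elem n g \<longleftrightarrow> (\<forall>p. g p \<in> adnil n (Suc p)) \<and> (\<exists>N. \<forall>p>N. symb n p (g p) = 0)"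
  unfolding gr_elem_def Dord_int using symb_eq_0_iff by blast

lemma gr_elem_Phi: "gr_elem n (Phi n F)"
  unfolding gr_elem_iff Phi_symb(2)
  by (intro conjI allI Phi_symb(1) exI[of _ "degree (sigma F)"]) (simp add: coeff_eq_0)

lemma gr_one_symb:
  "gr_one p \<in> adnil n (Suc p)" "symb n p (gr_one p) = (if p = 0 then 1 else 0)"
proof -
  show "gr_one p \<in> adnil n (Suc p)"
    by (simp add: gr_one_def adnil_zero id_adnil)
  show "symb n p (gr_one p) = (if p = 0 then 1 else 0)"
    by (simp add: gr_one_def symb_linear) (simp add: symb_def)
qed

lemma gr_eq_one: "gr_eq n (Phi n 1) gr_one"
  unfolding gr_eq_iff[OF Phi_symb(1) gr_one_symb(1)] Phi_symb(2) gr_one_symb(2) sigma_1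
  by (simp add: trunc_id)

lemma gr_eq_add: "gr_eq n (Phi n (F + G)) (gr_add (Phi n F) (Phi n G))"
proof -
  have "gr_add (Phi n F) (Phi n G) p \<in> adnil n (Suc p)" for p
    unfolding gr_add_def by (intro adnil_add Phi_symb)
  from gr_eq_iff[of "Phi n (F + G)" n "gr_add (Phi n F) (Phi n G)", OF Phi_symb(1) this]
  show ?thesis
    by (simp add: gr_add_def symb_linear Phi_symb(2) sigma_add coeff_add trunc_simps)
qed

lemma gr_eq_mult: "gr_eq n (Phi n (F * G)) (gr_mult (Phi n F) (Phi n G))"
proof -
  have c: "(\<lambda>u. Phi n F a (Phi n G (p - a) u)) \<in> adnil n (Suc p)"
    "symb n p (\<lambda>u. Phi n F a (Phi n G (p - a) u))
       = trunc n (coeff (sigma F) a * coeff (sigma G) (p - a))" if "a \<le> p" for a p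
    using symb_comp[OF Phi_symb(1)[of n F a] Phi_symb(1)[of n G "p - a"]] that
    by (simp_all add: Phi_symb(2) mod_mult_eq)
  have "gr_mult (Phi n F) (Phi n G) p \<in> adnil n (Suc p)" for p
    unfolding gr_mult_def by (intro adnil_sum c) simp
  from gr_eq_iff[of "Phi n (F * G)" n "gr_mult (Phi n F) (Phi n G)", OF Phi_symb(1) this]
  show ?thesis
    by (simp add: gr_mult_def symb_sum Phi_symb(2) sigma_mult coeff_mult trunc_sum c(2))
qed

lemma trunc_pderiv_mult:
  assumes "coeff g 0 = 0"
  shows "trunc n (pderiv (trunc n f) * trunc n g) = trunc n (pderiv f * g)"
proof -
  let ?X = "monom 1 (Suc n) :: 'a poly"
  have "pderiv f * g = pderiv (f div ?X * ?X + trunc n f) * g"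
    by (simp only: div_mult_mod_eq)
  also have "\<dots> = ?X * (pderiv (f div ?X) * g) + (f div ?X) * (pderiv ?X * g) + pderiv (trunc n f) * g"
    unfolding pderiv_add pderiv_mult by (simp only: algebra_simps)
  finally have eq: "pderiv f * g = \<dots>" .
  have "?X dvd pderiv ?X * g"
  proof -
    obtain c where "g = pCons 0 c" using assms by (cases g) auto
    then have "pderiv ?X * g = ?X * smult (of_nat (Suc n)) c"
      by (intro poly_eqI) (simp add: pderiv_monom coeff_monom_mult coeff_pCons split: nat.split)
    then show ?thesis by (metis dvd_triv_left)
  qed
  then have "trunc n (pderiv f * g) = trunc n (pderiv (trunc n f) * g)"
    unfolding eq trunc_simps by (simp add: mod_eq_0_iff_dvd)
  then show ?thesis by (simp add: mod_mult_right_eq)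
qed

lemma gr_eq_bracket: "gr_eq n (Phi n (pbracket F G)) (gr_bracket (Phi n F) (Phi n G))"
proof -
  let ?f = "coeff (sigma F)" and ?g = "coeff (sigma G)"
  define B where "B = (\<lambda>p a u. Phi n F a (Phi n G (Suc p - a) u) - Phi n G (Suc p - a) (Phi n F a u))"
  have gr: "gr_bracket (Phi n F) (Phi n G) p = (\<lambda>u. \<Sum>a\<le>Suc p. B p a u)" for p
    by (simp only: gr_bracket_def B_def)
  have B: "B p a \<in> adnil n (Suc p)"
    "symb n p (B p a) = trunc n (smult (of_nat (Suc p - a)) (pderiv (?f a) * ?g (Suc p - a))
        - smult (of_nat a) (?f a * pderiv (?g (Suc p - a))))" if a: "a \<le> Suc p" for a p
  proof -
    let ?b = "Suc p - a"
    have "a + ?b = Suc p" using a by simp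
    note c = symb_commutator[OF Phi_symb(1)[of n F a] Phi_symb(1)[of n G ?b] this]
    show "B p a \<in> adnil n (Suc p)" using c(1) by (simp only: B_def)
    have "smult (of_nat ?b) (trunc n (pderiv (trunc n (?f a)) * trunc n (?g ?b)))
        = smult (of_nat ?b) (trunc n (pderiv (?f a) * ?g ?b))"
    proof (cases "?b = 0")
      case False
      then have "coeff (?g ?b) 0 = 0" by (intro coeff_coeff_sigma_eq_0) simp
      then show ?thesis by (simp only: trunc_pderiv_mult)
    qed simp
    moreover have "smult (of_nat a) (trunc n (trunc n (?f a) * pderiv (trunc n (?g ?b))))
        = smult (of_nat a) (trunc n (?f a * pderiv (?g ?b)))"
    proof (cases "a = 0")
      case False
      then have "coeff (?f a) 0 = 0" by (intro coeff_coeff_sigma_eq_0) simp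
      then show ?thesis using trunc_pderiv_mult[of "?f a" "?g ?b" n] by (simp only: mult.commute)
    qed simp
    ultimately show "symb n p (B p a) = trunc n (smult (of_nat ?b) (pderiv (?f a) * ?g ?b)
        - smult (of_nat a) (?f a * pderiv (?g ?b)))"
      unfolding B_def c(2) Phi_symb(2) trunc_simps(2,3) by (simp only:)
  qed
  have "gr_bracket (Phi n F) (Phi n G) p \<in> adnil n (Suc p)" for p
    unfolding gr by (intro adnil_sum B(1)) simp
  note iff = gr_eq_iff[of "Phi n (pbracket F G)" n "gr_bracket (Phi n F) (Phi n G)",
      OF Phi_symb(1) this]
  have "coeff (sigma (pbracket F G)) p = (\<Sum>a\<le>Suc p.
      smult (of_nat (Suc p - a)) (pderiv (?f a) * ?g (Suc p - a))
        - smult (of_nat a) (?f a * pderiv (?g (Suc p - a))))" for p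
  proof -
    have of_nat_mult_smult: "of_nat m * h = smult (of_nat m) h" for m and h :: "'a poly"
      by (simp add: of_nat_poly)
    have "coeff (map_poly pderiv (sigma F) * pderiv (sigma G)) p
        = (\<Sum>a\<le>p. smult (of_nat (Suc p - a)) (pderiv (?f a) * ?g (Suc p - a)))"
      unfolding coeff_mult
      by (intro sum.cong refl)
        (simp add: coeff_map_poly coeff_pderiv of_nat_mult_smult Suc_diff_le mult_smult_right
          del: of_nat_Suc)
    moreover have "coeff (pderiv (sigma F) * map_poly pderiv (sigma G)) p
        = (\<Sum>a\<le>p. smult (of_nat (Suc a)) (?f (Suc a) * pderiv (?g (Suc p - Suc a))))"
      unfolding coeff_mult
      by (intro sum.cong refl)
        (simp add: coeff_map_poly coeff_pderiv of_nat_mult_smult del: of_nat_Suc)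
    moreover have "\<dots> = (\<Sum>a\<le>Suc p. smult (of_nat a) (?f a * pderiv (?g (Suc p - a))))"
      by (subst sum.atMost_Suc_shift) simp
    ultimately show ?thesis
      by (simp add: sigma_pbracket sum_subtractf)
  qed
  then show ?thesis
    unfolding iff Phi_symb(2) gr symb_sum by (simp only: trunc_sum) (simp add: B(2))
qed

section \<open>Kernel and image\<close>

lemma Ideal_n_I:
  "(z1 ^ 2 - z0 * z2) * G + (\<Sum>(a, b, c)\<in>{(a, b, c). a + b + c = Suc n}. H (a, b, c) * monomial3 a b c)
    \<in> Ideal_n n"
  unfolding Ideal_n_def by blast

lemma Ideal_n_add: "F \<in> Ideal_n n \<Longrightarrow> G \<in> Ideal_n n \<Longrightarrow> F + G \<in> Ideal_n n"
proof -
  let ?I = "{(a, b, c). a + b + c = Suc n}"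
  assume "F \<in> Ideal_n n" "G \<in> Ideal_n n"
  then obtain A H B K where
    "F = (z1 ^ 2 - z0 * z2) * A + (\<Sum>(a, b, c)\<in>?I. H (a, b, c) * monomial3 a b c)"
    "G = (z1 ^ 2 - z0 * z2) * B + (\<Sum>(a, b, c)\<in>?I. K (a, b, c) * monomial3 a b c)"
    unfolding Ideal_n_def by blast
  then have eq: "F + G = (z1 ^ 2 - z0 * z2) * (A + B)
      + (\<Sum>(a, b, c)\<in>?I. (\<lambda>t. H t + K t) (a, b, c) * monomial3 a b c)"
    by (simp add: distrib_left distrib_right sum.distrib case_prod_unfold)
  show ?thesis unfolding eq by (rule Ideal_n_I)
qed

lemma Ideal_n_relation: "(z1 ^ 2 - z0 * z2) * G \<in> Ideal_n n"
  using Ideal_n_I[of G "\<lambda>_. 0" n] by (simp add: case_prod_unfold)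

lemma Ideal_n_zero: "0 \<in> Ideal_n n"
  using Ideal_n_relation[of 0 n] by simp

lemma Ideal_n_sum: "(\<And>i. i \<in> I \<Longrightarrow> f i \<in> Ideal_n n) \<Longrightarrow> sum f I \<in> Ideal_n n"
  by (induction I rule: infinite_finite_induct) (simp_all add: Ideal_n_add Ideal_n_zero)

lemma finite_monomials: "finite {(a, b, c :: nat). a + b + c = Suc n}"
  by (rule finite_subset[of _ "{..Suc n} \<times> {..Suc n} \<times> {..Suc n}"]) auto

lemma Ideal_n_monomial3:
  assumes "a + b + c > n"
  shows "G * monomial3 a b c \<in> Ideal_n n"
proof -
  define a' b' c' where "a' = min a (Suc n)" and "b' = min b (Suc n - a')" and "c' = Suc n - a' - b'"
  have le: "a' \<le> a" "b' \<le> b" "c' \<le> c" and t: "a' + b' + c' = Suc n"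
    using assms by (auto simp: a'_def b'_def c'_def)
  define R where "R = G * (z0 ^ (a - a') * z1 ^ (b - b') * z2 ^ (c - c'))"
  have pw: "z ^ k = z ^ (k - j) * z ^ j" if "j \<le> k" for z :: "'a mpoly3" and j k
    using that by (simp flip: power_add)
  have "G * monomial3 a b c = R * monomial3 a' b' c'"
    unfolding monomial3_def R_def pw[OF le(1)] pw[OF le(2)] pw[OF le(3)] by (simp add: ac_simps)
  also have "\<dots> = (\<Sum>t\<in>{(a, b, c). a + b + c = Suc n}. if t = (a', b', c') then R * monomial3 a' b' c' else 0)"
    using t by (subst sum.delta[OF finite_monomials]) simp
  also have "\<dots> = (\<Sum>(a, b, c)\<in>{(a, b, c). a + b + c = Suc n}.
      (\<lambda>t. if t = (a', b', c') then R else 0) (a, b, c) * monomial3 a b c)" (is "_ = ?S")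
  proof (rule sum.cong[OF refl], clarify)
    fix a b c
    show "(if (a, b, c) = (a', b', c') then R * monomial3 a' b' c' else 0)
        = (\<lambda>t. if t = (a', b', c') then R else 0) (a, b, c) * monomial3 a b c"
      by (cases "(a, b, c) = (a', b', c')") auto
  qed
  finally have "G * monomial3 a b c = (z1 ^ 2 - z0 * z2) * 0 + ?S" by simp
  then show ?thesis
    using Ideal_n_I[of 0 "\<lambda>t. if t = (a', b', c') then R else 0" n] by (simp only:)
qed

text \<open>A monomial of total degree \<open>d\<close> and weight \<open>p \<le> 2 d\<close>; modulo \<open>z1^2 - z0 z2\<close> there is only one.\<close>

definition nf_monomial :: "nat \<Rightarrow> nat \<Rightarrow> 'a::idom mpoly3" where
  "nf_monomial d p = monomial3 (d - p mod 2 - p div 2) (p mod 2) (p div 2)"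

lemma nf_monomial_degree:
  fixes p d :: nat
  assumes "p \<le> 2 * d"
  shows "d - p mod 2 - p div 2 + p mod 2 + p div 2 = d"
proof -
  have "p mod 2 + p div 2 \<le> d" using assms by presburger
  then show ?thesis by linarith
qed

definition lift_sigma :: "nat \<Rightarrow> 'a::idom poly poly \<Rightarrow> 'a mpoly3" where
  "lift_sigma N h = (\<Sum>p\<le>N. \<Sum>d\<le>N. const3 (coeff (coeff h p) d) * nf_monomial d p)"

lemma const3_add: "const3 (r + s) = const3 r + const3 s"
  by simp

lemma lift_sigma_add: "lift_sigma N (g + h) = lift_sigma N g + lift_sigma N h"
  by (simp only: lift_sigma_def coeff_add const3_add distrib_right sum.distrib)

lemma lift_sigma_sum: "lift_sigma N (sum f I) = (\<Sum>i\<in>I. lift_sigma N (f i))"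
  by (induction I rule: infinite_finite_induct) (simp_all add: lift_sigma_add, simp_all add: lift_sigma_def)

lemma lift_sigma_monom:
  assumes "d \<le> N" "p \<le> N"
  shows "lift_sigma N (monom (monom r d) p) = const3 r * nf_monomial d p"
proof -
  define X where "X = const3 r * nf_monomial d p"
  have "const3 (coeff (coeff (monom (monom r d) p) p') d') * nf_monomial d' p'
      = (if p = p' then if d = d' then X else 0 else 0)" for p' d'
    by (simp add: X_def)
  then have "lift_sigma N (monom (monom r d) p)
      = (\<Sum>p'\<le>N. \<Sum>d'\<le>N. if p = p' then if d = d' then X else 0 else 0)"
    by (simp only: lift_sigma_def)
  also have "\<dots> = (\<Sum>p'\<le>N. if p = p' then X else 0)"
    using assms by (intro sum.cong refl) simp
  also have "\<dots> = X"
    using assms by simp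
  finally show ?thesis by (simp only: X_def)
qed

lemma monomial3_nf: "const3 r * monomial3 a b c - const3 r * nf_monomial (a + b + c) (b + 2 * c) \<in> Ideal_n n"
proof -
  define m where "m = b div 2"
  have b: "b = b mod 2 + 2 * m" by (simp add: m_def)
  have i: "(b + 2 * c) mod 2 = b mod 2" "(b + 2 * c) div 2 = c + m"
    by (simp_all add: m_def)
  have j: "a + b + c - b mod 2 - (c + m) = a + m"
    using b by linarith
  let ?r = "z0 ^ a * z1 ^ (b mod 2) * z2 ^ c :: 'a mpoly3"
  have A: "monomial3 a b c = ?r * (z1\<^sup>2) ^ m"
    unfolding monomial3_def by (subst b) (simp only: power_add power_mult, simp only: ac_simps)
  have B: "nf_monomial (a + b + c) (b + 2 * c) = ?r * (z0 * z2) ^ m"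
    unfolding nf_monomial_def i j monomial3_def by (simp add: power_add power_mult_distrib ac_simps)
  obtain Q :: "'a mpoly3" where Q: "(z1\<^sup>2) ^ m - (z0 * z2) ^ m = (z1\<^sup>2 - z0 * z2) * Q"
    using power_diff_sumr2[of "z1\<^sup>2" m "z0 * z2"] by blast
  have "const3 r * monomial3 a b c - const3 r * nf_monomial (a + b + c) (b + 2 * c)
      = const3 r * (?r * ((z1\<^sup>2) ^ m - (z0 * z2) ^ m))"
    by (simp only: A B right_diff_distrib)
  also have "\<dots> = (z1\<^sup>2 - z0 * z2) * (const3 r * (?r * Q))"
    by (simp only: Q mult.left_commute)
  finally show ?thesis by (simp only: Ideal_n_relation)
qed

lemma sigma_kernel:
  assumes "degrees_le M F"
  shows "F - lift_sigma (3 * M) (sigma F) \<in> Ideal_n n"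
proof -
  have "lift_sigma (3 * M) (sigma F) = (\<Sum>c\<le>M. \<Sum>b\<le>M. \<Sum>a\<le>M.
      const3 (coeff3 F a b c) * nf_monomial (a + b + c) (b + 2 * c))"
    by (subst mpoly3_decomp[OF assms], simp only: sigma_sum lift_sigma_sum sigma_const3_monomial3)
      (intro sum.cong refl, simp add: lift_sigma_monom)
  then have "F - lift_sigma (3 * M) (sigma F) = (\<Sum>c\<le>M. \<Sum>b\<le>M. \<Sum>a\<le>M.
      const3 (coeff3 F a b c) * monomial3 a b c
        - const3 (coeff3 F a b c) * nf_monomial (a + b + c) (b + 2 * c))"
    by (simp only: sum_subtractf mpoly3_decomp[OF assms, symmetric])
  then show ?thesis by (simp only:) (intro Ideal_n_sum monomial3_nf)
qed

lemma Ideal_n_iff: "F \<in> Ideal_n n \<longleftrightarrow> (\<forall>p. \<forall>d\<le>n. coeff (coeff (sigma F) p) d = 0)"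
proof
  let ?X = "monom 1 (Suc n) :: 'a poly"
  assume "F \<in> Ideal_n n"
  then obtain G H where F: "F = (z1 ^ 2 - z0 * z2) * G
      + (\<Sum>(a, b, c)\<in>{(a, b, c). a + b + c = Suc n}. H (a, b, c) * monomial3 a b c)"
    unfolding Ideal_n_def by blast
  have "sigma (z1 ^ 2 - z0 * z2) = (0 :: 'a poly poly)"
    by (simp add: sigma_diff sigma_mult sigma_power sigma_vars monom_power' mult_monom numeral_2_eq_2)
  then have "sigma F = (\<Sum>(a, b, c)\<in>{(a, b, c). a + b + c = Suc n}. sigma (H (a, b, c)) * sigma (monomial3 a b c))"
    by (simp add: F sigma_add sigma_mult sigma_sum case_prod_unfold)
  also have "\<dots> = (\<Sum>(a, b, c)\<in>{(a, b, c). a + b + c = Suc n}.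
      smult ?X (sigma (H (a, b, c)) * monom 1 (b + 2 * c)))"
  proof (rule sum.cong[OF refl], clarify)
    fix a b c :: nat assume "a + b + c = Suc n"
    then have "sigma (monomial3 a b c) = smult ?X (monom 1 (b + 2 * c))"
      by (simp add: sigma_monomial3 smult_monom)
    then show "sigma (H (a, b, c)) * sigma (monomial3 a b c) = smult ?X (sigma (H (a, b, c)) * monom 1 (b + 2 * c))"
      by simp
  qed
  also have "\<dots> = smult ?X (\<Sum>(a, b, c)\<in>{(a, b, c). a + b + c = Suc n}. sigma (H (a, b, c)) * monom 1 (b + 2 * c))"
    by (simp add: smult_sum_right case_prod_unfold)
  finally obtain R where "sigma F = smult ?X R" by blast
  then show "\<forall>p. \<forall>d\<le>n. coeff (coeff (sigma F) p) d = 0"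
    by (simp add: coeff_monom_mult)
next
  assume *: "\<forall>p. \<forall>d\<le>n. coeff (coeff (sigma F) p) d = 0"
  obtain M where M: "degrees_le M F" using degrees_le_exists by blast
  have "const3 (coeff (coeff (sigma F) p) d) * nf_monomial d p \<in> Ideal_n n" for d p
  proof (cases "n < d \<and> p \<le> 2 * d")
    case True
    then show ?thesis
      unfolding nf_monomial_def by (intro Ideal_n_monomial3) (simp only: nf_monomial_degree)
  next
    case False
    then have "coeff (coeff (sigma F) p) d = 0"
      using * coeff_coeff_sigma_eq_0[of d p F] by (meson not_le)
    then show ?thesis using Ideal_n_zero by simp
  qed
  then have "lift_sigma (3 * M) (sigma F) \<in> Ideal_n n"
    unfolding lift_sigma_def by (intro Ideal_n_sum)
  from Ideal_n_add[OF sigma_kernel[OF M] this] show "F \<in> Ideal_n n" by simp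
qed

lemma sigma_surj:
  assumes "\<And>p d. 2 * d < p \<Longrightarrow> coeff (coeff h p) d = 0"
  shows "\<exists>F. sigma F = h"
proof -
  obtain D where D: "\<And>p. degree (coeff h p) \<le> D"
    using bounded_coeffs[of degree h] by auto
  define N where "N = max D (degree h)"
  have N: "degree h \<le> N" "degree (coeff h p) \<le> N" for p
    using D[of p] by (auto simp: N_def)
  have "sigma (const3 (coeff (coeff h p) d) * nf_monomial d p) = monom (monom (coeff (coeff h p) d) d) p"
    for p d
  proof (cases "2 * d < p")
    case True
    then show ?thesis using assms by simp
  next
    case False
    then have p: "p \<le> 2 * d" by simp
    show ?thesis
      unfolding nf_monomial_def sigma_const3_monomial3 nf_monomial_degree[OF p] by simp
  qed
  then have "sigma (lift_sigma N h) = (\<Sum>p\<le>N. \<Sum>d\<le>N. monom (monom (coeff (coeff h p) d) d) p)"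
    by (simp only: lift_sigma_def sigma_sum)
  also have "\<dots> = h"
    using N by (simp add: poly_as_sum_of_monoms' flip: monom_sum)
  finally show ?thesis by blast
qed

lemma Phi_surj:
  assumes "gr_elem n g"
  shows "\<exists>F. gr_eq n (Phi n F) g"
proof -
  from assms obtain N where mem: "\<And>p. g p \<in> adnil n (Suc p)" and N: "\<And>p. p > N \<Longrightarrow> symb n p (g p) = 0"
    unfolding gr_elem_iff by blast
  define h where "h = (\<Sum>p\<le>N. monom (symb n p (g p)) p)"
  have h: "coeff h p = symb n p (g p)" for p
    using N[of p] by (simp add: h_def coeff_sum)
  have "\<exists>F. sigma F = h"
    by (rule sigma_surj) (simp add: h coeff_symb_eq_0[OF mem])
  then obtain F where "sigma F = h" by blast
  then have "gr_eq n (Phi n F) g"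
    unfolding gr_eq_iff[of "Phi n F" n g, OF Phi_symb(1) mem] Phi_symb(2)
    by (simp add: h trunc_id symb_On[OF adnil_End[OF mem]])
  then show ?thesis by blast
qed

lemma Phi_kernel: "gr_eq n (Phi n F) gr_zero \<longleftrightarrow> F \<in> Ideal_n n"
proof -
  have "gr_zero p \<in> adnil n (Suc p)" for p
    by (simp add: gr_zero_def adnil_zero)
  from gr_eq_iff[of "Phi n F" n gr_zero, OF Phi_symb(1) this] show ?thesis
    by (simp add: gr_zero_def symb_linear Phi_symb(2) trunc_eq_0_iff Ideal_n_iff)
qed

theorem theorem1:
  fixes n :: nat
  shows "(\<forall>F :: 'a::field_char_0 mpoly3. gr_elem n (Phi n F))
    \<and> gr_eq n (Phi n (1 :: 'a mpoly3)) gr_one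
    \<and> (\<forall>F G :: 'a mpoly3. gr_eq n (Phi n (F + G)) (gr_add (Phi n F) (Phi n G)))
    \<and> (\<forall>F G :: 'a mpoly3. gr_eq n (Phi n (F * G)) (gr_mult (Phi n F) (Phi n G)))
    \<and> (\<forall>F G :: 'a mpoly3. gr_eq n (Phi n (pbracket F G)) (gr_bracket (Phi n F) (Phi n G)))
    \<and> (\<forall>g. gr_elem n g \<longrightarrow> (\<exists>F :: 'a mpoly3. gr_eq n (Phi n F) g))
    \<and> (\<forall>F :: 'a mpoly3. gr_eq n (Phi n F) gr_zero \<longleftrightarrow> F \<in> Ideal_n n)"
  using gr_elem_Phi gr_eq_one gr_eq_add gr_eq_mult gr_eq_bracket Phi_surj Phi_kernel by blast

end
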